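(* Let $R$ be a commutative noetherian ring and let $\Delta$ be a subset of $\operatorname{Spec} R$. Then the weak torsion pairs in $\operatorname{Ass}^{-1}\Delta$ are exactly the torsion pairs in $\operatorname{Ass}^{-1}\Delta$, and there are a bijection $$\sigma:\{\text{torsion pairs in }\operatorname{Ass}^{-1}\Delta\}\longrightarrow\{\text{specialization-closed subsets of }\Delta\}$$ and a map $$\tau:\{\text{basic torsion pairs in }\operatorname{Ass}^{-1}\Delta\}\longrightarrow\{\text{closed subsets } C\text{ of }\Delta\text{ such that } C\sqcup C'=\Delta\text{ for some closed subset } C'\text{ of }\Delta\}$$ such that $\sigma\circ\mathrm{inc}=\mathrm{inc}\circ\tau$, where $\mathrm{inc}$ denotes, respectively, the inclusion of the set of basic torsion pairs in $\operatorname{Ass}^{-1}\Delta$ into the set of torsion pairs in $\operatorname{Ass}^{-1}\Delta$, and the inclusion of the target of $\tau$ into the target of $\sigma$. Moreover, $\tau$ is a bijection if $\Delta$ contains $\operatorname{Min} R$.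
   Context: $\operatorname{mod} R$ is the category of finitely generated $R$-modules. All subcategories are full and closed under isomorphisms. $\operatorname{Min} R$ is the set of minimal prime ideals of $R$. For $\Delta\subseteq\operatorname{Spec}R$, $\operatorname{Ass}^{-1}\Delta=\{M\in\operatorname{mod}R\mid \operatorname{Ass}M\subseteq\Delta\}$. The set $\Delta$ carries the subspace topology induced by the Zariski topology on $\operatorname{Spec}R$; a subset $Z$ of a topological space $X$ is specialization-closed if the closure of $\{z\}$ in $X$ is contained in $Z$ for every $z\in Z$. The symbol $C\sqcup C'=\Delta$ means $C\cup C'=\Delta$ and $C\cap C'=\emptyset$. Let $\mathcal X$ be a subcategory of $\operatorname{mod}R$ and $(\mathcal T,\mathcal F)$ a pair of subcategories of $\mathcal X$. - $(\mathcal T,\mathcal F)$ is a weak torsion pair in $\mathcal X$ if $\mathcal T=\{X\in\mathcal X\mid\operatorname{Hom}_R(X,F)=0\ \forall F\in\mathcal F\}$ and $\mathcal F=\{X\in\mathcal X\mid\operatorname{Hom}_R(T,X)=0\ \forall T\in\mathcal T\}$. - If $\mathcal X$ is closed under extensions in $\operatorname{mod}R$, $(\mathcal T,\mathcal F)$ is a torsion pair in $\mathcal X$ if $\operatorname{Hom}_R(T,F)=0$ for all $T\in\mathcal T$, $F\in\mathcal F$, and every $X\in\mathcal X$ admits a short exact sequence $0\to T\to X\to F\to0$ in $\operatorname{mod}R$ with $T\in\mathcal T$ and $F\in\mathcal F$. - $(\mathcal T,\mathcal F)$ is a basic torsion pair in $\mathcal X$ if it is a torsion pair in $\mathcal X$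 and there are ideals $I,J$ of $R$ with $\mathcal T=\{X\in\mathcal X\mid IX=0\}$ and $\mathcal F=\{X\in\mathcal X\mid JX=0\}$. *)

theory Defs
  imports
    "HOL-Algebra.Module"
    "HOL-Algebra.Ideal"
    "HOL-Algebra.Ring_Divisibility"
    "HOL-Analysis.Abstract_Topology"
begin

section \<open>The prime spectrum\<close>

definition Spec :: "('a, 'm) ring_scheme \<Rightarrow> 'a set set" where
  "Spec R = {p. primeideal p R}"

definition Min_primes :: "('a, 'm) ring_scheme \<Rightarrow> 'a set set" where
  "Min_primes R = {p \<in> Spec R. \<forall>q \<in> Spec R. q \<subseteq> p \<longrightarrow> q = p}"

definition V :: "('a, 'm) ring_scheme \<Rightarrow> 'a set \<Rightarrow> 'a set set" where
  "V R I = {p \<in> Spec R. I \<subseteq> p}"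

definition zariski :: "('a, 'm) ring_scheme \<Rightarrow> 'a set topology" where
  "zariski R = topology (\<lambda>U. \<exists>I. ideal I R \<and> U = Spec R - V R I)"

text \<open>
  \<^const>\<open>topology\<close> is only meaningful on predicates satisfying \<^const>\<open>istopology\<close>; the next
  lemmas discharge this for commutative rings and recover the usual closed sets.
\<close>

lemma istopology_zariski:
  assumes "cring R"
  shows "istopology (\<lambda>U. \<exists>I. ideal I R \<and> U = Spec R - V R I)"
  unfolding istopology_def
proof (intro conjI allI impI)
  interpret cring R by fact
  fix S T
  assume "\<exists>I. ideal I R \<and> S = Spec R - V R I" "\<exists>I. ideal I R \<and> T = Spec R - V R I"
  then obtain I J where I: "ideal I R" "S = Spec R - V R I"
    and J: "ideal J R" "T = Spec R - V R J"
    by blast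
  have "I \<subseteq> p \<or> J \<subseteq> p" if p: "primeideal p R" and sub: "I \<inter> J \<subseteq> p" for p
  proof (rule ccontr)
    assume "\<not> ?thesis"
    then obtain a b where ab: "a \<in> I" "a \<notin> p" "b \<in> J" "b \<notin> p" by blast
    have c: "a \<in> carrier R" "b \<in> carrier R"
      using ab I(1) J(1) by (auto dest: ideal.Icarr)
    have "a \<otimes>\<^bsub>R\<^esub> b \<in> I \<inter> J"
      using ab c I(1) J(1) by (simp add: ideal.I_l_closed ideal.I_r_closed)
    then show False
      using primeideal.I_prime[OF p] ab c sub by blast
  qed
  then have "S \<inter> T = Spec R - V R (I \<inter> J)"
    using I J by (auto simp: V_def Spec_def)
  moreover have "ideal (I \<inter> J) R"
    using I J by (simp add: i_intersect)
  ultimately show "\<exists>I. ideal I R \<and> S \<inter> T = Spec R - V R I" by blast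
next
  interpret cring R by fact
  fix K
  assume K: "\<forall>U\<in>K. \<exists>I. ideal I R \<and> U = Spec R - V R I"
  define F where "F = {I. ideal I R \<and> Spec R - V R I \<in> K}"
  have F: "\<Union>F \<subseteq> carrier R"
    by (auto simp: F_def dest: ideal.Icarr)
  have "Idl\<^bsub>R\<^esub> (\<Union>F) \<subseteq> p \<longleftrightarrow> \<Union>F \<subseteq> p" if "primeideal p R" for p
    using genideal_self[OF F] genideal_minimal[of p "\<Union>F"] that
    by (auto simp: primeideal_def)
  then have "V R (Idl\<^bsub>R\<^esub> (\<Union>F)) = V R (\<Union>F)"
    by (auto simp: V_def Spec_def)
  moreover have "\<Union>K = (\<Union>I\<in>F. Spec R - V R I)"
  proof
    show "\<Union>K \<subseteq> (\<Union>I\<in>F. Spec R - V R I)"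
    proof
      fix p assume "p \<in> \<Union>K"
      then obtain U where U: "U \<in> K" "p \<in> U" by blast
      with K obtain I where "ideal I R" "U = Spec R - V R I" by blast
      then show "p \<in> (\<Union>I\<in>F. Spec R - V R I)"
        using U by (intro UN_I[of I]) (simp_all add: F_def)
    qed
    show "(\<Union>I\<in>F. Spec R - V R I) \<subseteq> \<Union>K"
      by (rule UN_least) (simp add: F_def Union_upper)
  qed
  moreover have "(\<Union>I\<in>F. Spec R - V R I) = Spec R - V R (\<Union>F)"
    unfolding V_def by blast
  ultimately have "\<Union>K = Spec R - V R (Idl\<^bsub>R\<^esub> (\<Union>F))"
    by simp
  then show "\<exists>I. ideal I R \<and> \<Union>K = Spec R - V R I"
    using genideal_ideal[OF F] by blast
qed

lemma openin_zariski:
  assumes "cring R"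
  shows "openin (zariski R) U \<longleftrightarrow> (\<exists>I. ideal I R \<and> U = Spec R - V R I)"
  unfolding zariski_def using topology_inverse'[OF istopology_zariski[OF assms]] by simp

lemma topspace_zariski:
  assumes "cring R"
  shows "topspace (zariski R) = Spec R"
proof -
  interpret cring R by fact
  have "V R (carrier R) = {}"
    by (auto simp: V_def Spec_def dest: primeideal.I_notcarr ideal.Icarr[OF primeideal.axioms(1)])
  then have "openin (zariski R) (Spec R)"
    using oneideal by (auto simp: openin_zariski[OF assms])
  then show ?thesis
    by (auto simp: topspace_def openin_zariski[OF assms])
qed

lemma closedin_zariski:
  assumes "cring R"
  shows "closedin (zariski R) C \<longleftrightarrow> (\<exists>I. ideal I R \<and> C = V R I)"
proof -
  have "V R I \<subseteq> Spec R" for I by (auto simp: V_def)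
  then show ?thesis
    unfolding closedin_def topspace_zariski[OF assms] openin_zariski[OF assms]
    by (metis Diff_Diff_Int Diff_subset inf.absorb_iff2)
qed

definition specialization_closedin :: "'x topology \<Rightarrow> 'x set \<Rightarrow> bool" where
  "specialization_closedin X Z \<longleftrightarrow> Z \<subseteq> topspace X \<and> (\<forall>z\<in>Z. X closure_of {z} \<subseteq> Z)"

definition specialization_closed_subsets :: "('a, 'm) ring_scheme \<Rightarrow> 'a set set \<Rightarrow> 'a set set set"
  where "specialization_closed_subsets R \<Delta> =
    {Z. specialization_closedin (subtopology (zariski R) \<Delta>) Z}"

definition complemented_closed_subsets :: "('a, 'm) ring_scheme \<Rightarrow> 'a set set \<Rightarrow> 'a set set set"
  where "complemented_closed_subsets R \<Delta> =
    {C. closedin (subtopology (zariski R) \<Delta>) C \<and>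
        (\<exists>C'. closedin (subtopology (zariski R) \<Delta>) C' \<and> C \<union> C' = \<Delta> \<and> C \<inter> C' = {})}"


section \<open>Finitely generated modules\<close>

definition lin_maps ::
  "('a, 'm) ring_scheme \<Rightarrow> ('a, 'b, 'c) module_scheme \<Rightarrow> ('a, 'd, 'e) module_scheme \<Rightarrow> ('b \<Rightarrow> 'd) set"
  where "lin_maps R M N =
    {f \<in> hom (add_monoid M) (add_monoid N).
       \<forall>a\<in>carrier R. \<forall>x\<in>carrier M. f (a \<odot>\<^bsub>M\<^esub> x) = a \<odot>\<^bsub>N\<^esub> f x}"

definition Hom_zero ::
  "('a, 'm) ring_scheme \<Rightarrow> ('a, 'b, 'c) module_scheme \<Rightarrow> ('a, 'd, 'e) module_scheme \<Rightarrow> bool"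
  where "Hom_zero R M N \<longleftrightarrow> (\<forall>f\<in>lin_maps R M N. \<forall>x\<in>carrier M. f x = \<zero>\<^bsub>N\<^esub>)"

definition lin_iso ::
  "('a, 'm) ring_scheme \<Rightarrow> ('a, 'b, 'c) module_scheme \<Rightarrow> ('a, 'd, 'e) module_scheme \<Rightarrow> bool"
  where "lin_iso R M N \<longleftrightarrow> (\<exists>f\<in>lin_maps R M N. bij_betw f (carrier M) (carrier N))"

definition short_exact ::
  "('a, 'm) ring_scheme \<Rightarrow> ('a, 'b, 'c) module_scheme \<Rightarrow> ('a, 'd, 'e) module_scheme
     \<Rightarrow> ('a, 'f, 'g) module_scheme \<Rightarrow> ('b \<Rightarrow> 'd) \<Rightarrow> ('d \<Rightarrow> 'f) \<Rightarrow> bool"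
  where "short_exact R L M N f g \<longleftrightarrow>
    f \<in> lin_maps R L M \<and> g \<in> lin_maps R M N \<and>
    inj_on f (carrier L) \<and> f ` carrier L = {x \<in> carrier M. g x = \<zero>\<^bsub>N\<^esub>} \<and>
    g ` carrier M = carrier N"

definition finitely_generated :: "('a, 'm) ring_scheme \<Rightarrow> ('a, 'b, 'c) module_scheme \<Rightarrow> bool" where
  "finitely_generated R M \<longleftrightarrow>
    (\<exists>A. finite A \<and> A \<subseteq> carrier M \<and>
      (\<forall>x\<in>carrier M. \<exists>c\<in>A \<rightarrow> carrier R. x = (\<Oplus>\<^bsub>M\<^esub>a\<in>A. c a \<odot>\<^bsub>M\<^esub> a)))"

text \<open>
  The finitely generated modules over a ring form a proper class, so the underlying sets have to be
  taken from a fixed type. Lists over the ring suffice: a module with \<open>n\<close> generators is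
  isomorphic to one whose elements are lists of length \<open>n\<close> (choose one coefficient list for
  every element), see \<open>mod_cat_representative\<close> below. As all subcategories are full and
  closed under isomorphisms, they are determined by their members in this set. (The fields
  \<^const>\<open>mult\<close> and \<^const>\<open>one\<close> of a module record carry no information and are ignored by
  \<^const>\<open>lin_iso\<close>, so isomorphism-closed classes do not see them.)
\<close>

definition mod_cat :: "('a, 'm) ring_scheme \<Rightarrow> ('a, 'a list) module set" where
  "mod_cat R = {M. module R M \<and> finitely_generated R M}"

text \<open>The module structure transported along a map that is injective on the carrier.\<close>

definition transport :: "('b \<Rightarrow> 'd) \<Rightarrow> ('a, 'b, 'c) module_scheme \<Rightarrow> ('a, 'd) module" where
  "transport e M = (let d = inv_into (carrier M) e in
    \<lparr>carrier = e ` carrier M,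
     mult = (\<lambda>x y. e (d x \<otimes>\<^bsub>M\<^esub> d y)), one = e \<one>\<^bsub>M\<^esub>,
     zero = e \<zero>\<^bsub>M\<^esub>, add = (\<lambda>x y. e (d x \<oplus>\<^bsub>M\<^esub> d y)),
     smult = (\<lambda>a x. e (a \<odot>\<^bsub>M\<^esub> d x))\<rparr>)"

lemma transport_module:
  assumes "module R M" and inj: "inj_on e (carrier M)"
  shows "module R (transport e M)" and "e \<in> lin_maps R M (transport e M)"
    and "lin_iso R M (transport e M)"
proof -
  interpret module R M by fact
  let ?N = "transport e M"
  have carr: "carrier ?N = e ` carrier M" and zero: "\<zero>\<^bsub>?N\<^esub> = e \<zero>\<^bsub>M\<^esub>"
    by (simp_all add: transport_def Let_def)
  have add: "e x \<oplus>\<^bsub>?N\<^esub> e y = e (x \<oplus>\<^bsub>M\<^esub> y)" if "x \<in> carrier M" "y \<in> carrier M" for x y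
    using that inj by (simp add: transport_def Let_def)
  have smult: "a \<odot>\<^bsub>?N\<^esub> e x = e (a \<odot>\<^bsub>M\<^esub> x)" if "x \<in> carrier M" for a x
    using that inj by (simp add: transport_def Let_def)
  have ab: "abelian_group ?N"
  proof (rule abelian_groupI; unfold carr zero)
    fix x assume "x \<in> e ` carrier M"
    then obtain u where u: "u \<in> carrier M" "x = e u" by blast
    then show "\<exists>y\<in>e ` carrier M. y \<oplus>\<^bsub>?N\<^esub> x = e \<zero>\<^bsub>M\<^esub>"
      by (intro bexI[of _ "e (\<ominus>\<^bsub>M\<^esub> u)"]) (simp_all add: add M.l_neg)
    show "e \<zero>\<^bsub>M\<^esub> \<oplus>\<^bsub>?N\<^esub> x = x" using u by (simp add: add)
    fix y assume "y \<in> e ` carrier M"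
    then obtain v where v: "v \<in> carrier M" "y = e v" by blast
    show "x \<oplus>\<^bsub>?N\<^esub> y \<in> e ` carrier M" using u v by (simp add: add)
    show "x \<oplus>\<^bsub>?N\<^esub> y = y \<oplus>\<^bsub>?N\<^esub> x" using u v by (simp add: add M.a_comm)
    fix z assume "z \<in> e ` carrier M"
    then obtain w where w: "w \<in> carrier M" "z = e w" by blast
    show "x \<oplus>\<^bsub>?N\<^esub> y \<oplus>\<^bsub>?N\<^esub> z = x \<oplus>\<^bsub>?N\<^esub> (y \<oplus>\<^bsub>?N\<^esub> z)"
      using u v w by (simp add: add M.a_assoc)
  qed simp
  show "module R ?N"
    by (rule moduleI[OF R.is_cring ab]; unfold carr; elim imageE; hypsubst)
       (simp_all add: add smult smult_l_distr smult_r_distr smult_assoc1)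
  show lin: "e \<in> lin_maps R M ?N"
    by (simp add: lin_maps_def hom_def carr add smult)
  show "lin_iso R M ?N"
    unfolding lin_iso_def using lin inj carr by (blast intro: bij_betw_imageI)
qed

lemma transport_finitely_generated:
  assumes "module R M" and inj: "inj_on e (carrier M)" and "finitely_generated R M"
  shows "finitely_generated R (transport e M)"
proof -
  interpret module R M by fact
  interpret N: module R "transport e M" by (rule transport_module[OF assms(1) inj])
  note lin = transport_module(2)[OF assms(1) inj]
  have e_closed: "e x \<in> carrier (transport e M)" if "x \<in> carrier M" for x
    using that by (simp add: transport_def Let_def)
  have e_zero: "e \<zero>\<^bsub>M\<^esub> = \<zero>\<^bsub>transport e M\<^esub>"
    by (simp add: transport_def Let_def)
  have e_add: "e (x \<oplus>\<^bsub>M\<^esub> y) = e x \<oplus>\<^bsub>transport e M\<^esub> e y"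
    if "x \<in> carrier M" "y \<in> carrier M" for x y
    using lin that by (auto simp: lin_maps_def hom_def)
  have e_smult: "e (a \<odot>\<^bsub>M\<^esub> x) = a \<odot>\<^bsub>transport e M\<^esub> e x"
    if "a \<in> carrier R" "x \<in> carrier M" for a x
    using lin that by (auto simp: lin_maps_def)
  obtain A where A: "finite A" "A \<subseteq> carrier M"
    and gen: "\<And>x. x \<in> carrier M \<Longrightarrow> \<exists>c\<in>A \<rightarrow> carrier R. x = (\<Oplus>\<^bsub>M\<^esub>a\<in>A. c a \<odot>\<^bsub>M\<^esub> a)"
    using assms(3) unfolding finitely_generated_def by blast
  have sum: "e (\<Oplus>\<^bsub>M\<^esub>a\<in>B. c a \<odot>\<^bsub>M\<^esub> a) =
      (\<Oplus>\<^bsub>transport e M\<^esub>b\<in>e ` B. c (inv_into (carrier M) e b) \<odot>\<^bsub>transport e M\<^esub> b)"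
    if "finite B" "B \<subseteq> carrier M" "c \<in> B \<rightarrow> carrier R" for B c
    using that
  proof (induction B)
    case empty
    then show ?case by (simp add: e_zero)
  next
    case (insert b B)
    have notin: "e b \<notin> e ` B"
      using insert.hyps insert.prems inj by (auto dest: inj_onD)
    have c: "c \<in> B \<rightarrow> carrier R" "c b \<in> carrier R" and B: "B \<subseteq> carrier M" "b \<in> carrier M"
      using insert.prems by auto
    have "e (\<Oplus>\<^bsub>M\<^esub>a\<in>insert b B. c a \<odot>\<^bsub>M\<^esub> a)
        = e (c b \<odot>\<^bsub>M\<^esub> b \<oplus>\<^bsub>M\<^esub> (\<Oplus>\<^bsub>M\<^esub>a\<in>B. c a \<odot>\<^bsub>M\<^esub> a))"
      using insert.hyps c B by (subst M.finsum_insert) auto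
    also have "\<dots> = c b \<odot>\<^bsub>transport e M\<^esub> e b \<oplus>\<^bsub>transport e M\<^esub> e (\<Oplus>\<^bsub>M\<^esub>a\<in>B. c a \<odot>\<^bsub>M\<^esub> a)"
      using c B by (subst e_add) (auto simp: e_smult intro!: M.finsum_closed)
    also have "\<dots> = (\<Oplus>\<^bsub>transport e M\<^esub>b\<in>insert (e b) (e ` B).
        c (inv_into (carrier M) e b) \<odot>\<^bsub>transport e M\<^esub> b)"
      using insert.hyps insert.IH[OF B(1) c(1)] c B notin inj
      by (subst N.M.finsum_insert)
         (auto simp: subset_iff Pi_iff intro!: e_closed)
    finally show ?case by simp
  qed
  show ?thesis
    unfolding finitely_generated_def
  proof (intro exI[of _ "e ` A"] conjI ballI)
    show "finite (e ` A)" "e ` A \<subseteq> carrier (transport e M)"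
      using A by (auto intro: e_closed)
    fix y assume "y \<in> carrier (transport e M)"
    then obtain x where x: "x \<in> carrier M" "y = e x" by (auto simp: transport_def Let_def)
    obtain c where c: "c \<in> A \<rightarrow> carrier R" "x = (\<Oplus>\<^bsub>M\<^esub>a\<in>A. c a \<odot>\<^bsub>M\<^esub> a)"
      using gen[OF x(1)] by blast
    show "\<exists>c\<in>e ` A \<rightarrow> carrier R. y = (\<Oplus>\<^bsub>transport e M\<^esub>b\<in>e ` A. c b \<odot>\<^bsub>transport e M\<^esub> b)"
    proof (rule bexI[of _ "c \<circ> inv_into (carrier M) e"])
      show "c \<circ> inv_into (carrier M) e \<in> e ` A \<rightarrow> carrier R"
        using c(1) A(2) inj by (auto simp: Pi_iff subset_iff)
      show "y = (\<Oplus>\<^bsub>transport e M\<^esub>b\<in>e ` A. (c \<circ> inv_into (carrier M) e) b \<odot>\<^bsub>transport e M\<^esub> b)"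
        using sum[OF A c(1)] c(2) x(2) by simp
    qed
  qed
qed

theorem mod_cat_representative:
  fixes R :: "('a, 'm) ring_scheme" and M :: "('a, 'b, 'c) module_scheme"
  assumes "module R M" and "finitely_generated R M"
  shows "\<exists>N\<in>mod_cat R. lin_iso R M N"
proof -
  interpret module R M by fact
  obtain A where A: "finite A" "A \<subseteq> carrier M"
    and gen: "\<And>x. x \<in> carrier M \<Longrightarrow> \<exists>c\<in>A \<rightarrow> carrier R. x = (\<Oplus>\<^bsub>M\<^esub>a\<in>A. c a \<odot>\<^bsub>M\<^esub> a)"
    using assms(2) unfolding finitely_generated_def by blast
  obtain as where as: "set as = A" using finite_list[OF A(1)] by blast
  obtain c where c: "\<And>x. x \<in> carrier M \<Longrightarrow> c x \<in> A \<rightarrow> carrier R \<and> x = (\<Oplus>\<^bsub>M\<^esub>a\<in>A. c x a \<odot>\<^bsub>M\<^esub> a)"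
    using gen by metis
  define e where "e x = map (c x) as" for x
  have "inj_on e (carrier M)"
  proof (rule inj_onI)
    fix x y assume xy: "x \<in> carrier M" "y \<in> carrier M" "e x = e y"
    then have "c x a = c y a" if "a \<in> A" for a
      using that as by (auto simp: e_def)
    then have "(\<Oplus>\<^bsub>M\<^esub>a\<in>A. c x a \<odot>\<^bsub>M\<^esub> a) = (\<Oplus>\<^bsub>M\<^esub>a\<in>A. c y a \<odot>\<^bsub>M\<^esub> a)"
      using c[OF xy(2)] A(2) by (intro M.finsum_cong') (auto simp: Pi_iff subset_iff)
    then show "x = y" using c[OF xy(1)] c[OF xy(2)] by metis
  qed
  then show ?thesis
    using transport_module[OF assms(1)] transport_finitely_generated[OF assms(1) _ assms(2)]
    unfolding mod_cat_def by blast
qed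

definition annihilator :: "('a, 'm) ring_scheme \<Rightarrow> ('a, 'b, 'c) module_scheme \<Rightarrow> 'b \<Rightarrow> 'a set" where
  "annihilator R M x = {a \<in> carrier R. a \<odot>\<^bsub>M\<^esub> x = \<zero>\<^bsub>M\<^esub>}"

definition Ass :: "('a, 'm) ring_scheme \<Rightarrow> ('a, 'b, 'c) module_scheme \<Rightarrow> 'a set set" where
  "Ass R M = {p \<in> Spec R. \<exists>x\<in>carrier M. p = annihilator R M x}"

definition Ass_inv :: "('a, 'm) ring_scheme \<Rightarrow> 'a set set \<Rightarrow> ('a, 'a list) module set" where
  "Ass_inv R \<Delta> = {M \<in> mod_cat R. Ass R M \<subseteq> \<Delta>}"


section \<open>Torsion pairs\<close>

text \<open>
  A full, isomorphism-closed subcategory is identified with its set of objects.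
\<close>

definition subcategory ::
  "('a, 'm) ring_scheme \<Rightarrow> ('a, 'a list) module set \<Rightarrow> ('a, 'a list) module set \<Rightarrow> bool" where
  "subcategory R X Y \<longleftrightarrow> Y \<subseteq> X \<and> (\<forall>M\<in>Y. \<forall>N\<in>mod_cat R. lin_iso R M N \<longrightarrow> N \<in> Y)"

definition extension_closed :: "('a, 'm) ring_scheme \<Rightarrow> ('a, 'a list) module set \<Rightarrow> bool" where
  "extension_closed R X \<longleftrightarrow>
    (\<forall>L\<in>X. \<forall>N\<in>X. \<forall>M\<in>mod_cat R. (\<exists>f g. short_exact R L M N f g) \<longrightarrow> M \<in> X)"

type_synonym 'a mod_pair = "('a, 'a list) module set \<times> ('a, 'a list) module set"

definition weak_torsion_pairs ::
  "('a, 'm) ring_scheme \<Rightarrow> ('a, 'a list) module set \<Rightarrow> 'a mod_pair set" where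
  "weak_torsion_pairs R X =
    {(T, F). subcategory R X T \<and> subcategory R X F \<and>
       T = {M \<in> X. \<forall>N\<in>F. Hom_zero R M N} \<and>
       F = {M \<in> X. \<forall>N\<in>T. Hom_zero R N M}}"

text \<open>
  Torsion pairs are only considered in extension-closed \<open>X\<close>; this standing requirement is part
  of the definition, so there are no torsion pairs in other \<open>X\<close>.
\<close>

definition torsion_pairs ::
  "('a, 'm) ring_scheme \<Rightarrow> ('a, 'a list) module set \<Rightarrow> 'a mod_pair set" where
  "torsion_pairs R X =
    {(T, F). extension_closed R X \<and> subcategory R X T \<and> subcategory R X F \<and>
       (\<forall>M\<in>T. \<forall>N\<in>F. Hom_zero R M N) \<and>
       (\<forall>M\<in>X. \<exists>L\<in>T. \<exists>N\<in>F. \<exists>f g. short_exact R L M N f g)}"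

definition annihilated_by ::
  "('a, 'm) ring_scheme \<Rightarrow> ('a, 'a list) module set \<Rightarrow> 'a set \<Rightarrow> ('a, 'a list) module set" where
  "annihilated_by R X I = {M \<in> X. \<forall>a\<in>I. \<forall>x\<in>carrier M. a \<odot>\<^bsub>M\<^esub> x = \<zero>\<^bsub>M\<^esub>}"

definition basic_torsion_pairs ::
  "('a, 'm) ring_scheme \<Rightarrow> ('a, 'a list) module set \<Rightarrow> 'a mod_pair set" where
  "basic_torsion_pairs R X =
    {(T, F) \<in> torsion_pairs R X. \<exists>I J. ideal I R \<and> ideal J R \<and>
       T = annihilated_by R X I \<and> F = annihilated_by R X J}"

end

theory Submission
  imports Defs
begin

text \<open>
  The proof rests on one criterion, \<open>Hom_zero_iff_Ass\<close>: for a finitely generated module \<open>M\<close> over a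
  noetherian ring, \<open>Hom(M, N) = 0\<close> holds exactly if no associated prime of \<open>M\<close> is contained in an
  associated prime of \<open>N\<close>. So whether two modules are orthogonal depends only on their associated
  primes and on the inclusion order among them, and the classification of torsion pairs turns into
  a statement about sets of primes.

  Let \<open>(T, F)\<close> be a weak torsion pair in the category of modules with all associated primes in
  \<open>\<Delta>\<close>, and let \<open>Z\<close> be the set of those primes in \<open>\<Delta>\<close> that contain an associated prime of some
  module in \<open>T\<close>. Then \<open>Z\<close> is specialization-closed in \<open>\<Delta>\<close>, and by the criterion \<open>F\<close> consists of the
  modules whose associated primes lie in \<open>\<Delta> - Z\<close>. Conversely, start from a specialization-closed
  set \<open>Z\<close>. The modules with associated primes in \<open>Z\<close> and those with associated primes in
  \<open>\<Delta> - Z\<close> are orthogonal, by the criterion. They form a torsion pair because every module \<open>M\<close> has a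
  submodule \<open>L\<close> such that the associated primes of \<open>L\<close> are in \<open>Z\<close> and those of \<open>M/L\<close> are associated
  primes of \<open>M\<close> outside \<open>Z\<close> (\<open>short_exact_splitting_Ass\<close>). Every torsion pair is a weak torsion pair,
  and each half of a weak torsion pair determines the other half, so torsion pairs and weak torsion
  pairs are both the pairs \<open>Ass_pair R \<Delta> Z\<close> with \<open>Z\<close> specialization-closed. The set \<open>Z\<close> is
  recovered as the union of the sets of associated primes of the modules in \<open>T\<close>, since \<open>R/p\<close>
  belongs to \<open>T\<close> for each \<open>p\<close> in \<open>Z\<close>. This union is \<open>\<sigma>\<close>, and \<open>\<tau>\<close> is its restriction.

  If the pair is basic with ideals \<open>I\<close> and \<open>J\<close>, then testing the modules \<open>R/p\<close> shows that \<open>Z\<close> and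
  \<open>\<Delta> - Z\<close> are the traces on \<open>\<Delta>\<close> of the closed sets \<open>V(I)\<close> and \<open>V(J)\<close>. Conversely, let these
  traces be complementary in \<open>\<Delta>\<close>, and let \<open>\<Delta>\<close> contain the minimal primes. Each minimal prime contains
  \<open>I\<close> or \<open>J\<close>, so each product \<open>ab\<close> with \<open>a\<close> in \<open>I\<close> and \<open>b\<close> in \<open>J\<close> is nilpotent. This forces some power of
  \<open>a\<close> to kill all modules in \<open>T\<close> at once (\<open>complemented_closed_annihilated\<close>). Hence the common
  annihilator of the modules in \<open>T\<close> lies in the same primes of \<open>\<Delta>\<close> as \<open>I\<close> does, and it defines
  \<open>T\<close>; exchanging \<open>I\<close> and \<open>J\<close> gives the ideal for \<open>F\<close>.
\<close>


section \<open>Submodules and linear maps\<close>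

lemma lin_mapsD:
  assumes "f \<in> lin_maps R M N"
  shows "x \<in> carrier M \<Longrightarrow> f x \<in> carrier N"
    and "x \<in> carrier M \<Longrightarrow> y \<in> carrier M \<Longrightarrow> f (x \<oplus>\<^bsub>M\<^esub> y) = f x \<oplus>\<^bsub>N\<^esub> f y"
    and "a \<in> carrier R \<Longrightarrow> x \<in> carrier M \<Longrightarrow> f (a \<odot>\<^bsub>M\<^esub> x) = a \<odot>\<^bsub>N\<^esub> f x"
  using assms by (auto simp: lin_maps_def hom_def)

lemma lin_mapsI:
  assumes "\<And>x. x \<in> carrier M \<Longrightarrow> f x \<in> carrier N"
    and "\<And>x y. x \<in> carrier M \<Longrightarrow> y \<in> carrier M \<Longrightarrow> f (x \<oplus>\<^bsub>M\<^esub> y) = f x \<oplus>\<^bsub>N\<^esub> f y"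
    and "\<And>a x. a \<in> carrier R \<Longrightarrow> x \<in> carrier M \<Longrightarrow> f (a \<odot>\<^bsub>M\<^esub> x) = a \<odot>\<^bsub>N\<^esub> f x"
  shows "f \<in> lin_maps R M N"
  using assms by (auto simp: lin_maps_def hom_def)

lemma lin_maps_comp:
  assumes "f \<in> lin_maps R L M" and "g \<in> lin_maps R M N"
  shows "(\<lambda>x. g (f x)) \<in> lin_maps R L N"
  using assms by (intro lin_mapsI) (simp_all add: lin_mapsD)

lemma lin_maps_zero:
  assumes "module R M" "module R N" "f \<in> lin_maps R M N"
  shows "f \<zero>\<^bsub>M\<^esub> = \<zero>\<^bsub>N\<^esub>"
proof -
  interpret M: module R M by fact
  interpret N: module R N by fact
  have "f (\<zero>\<^bsub>R\<^esub> \<odot>\<^bsub>M\<^esub> \<zero>\<^bsub>M\<^esub>) = \<zero>\<^bsub>R\<^esub> \<odot>\<^bsub>N\<^esub> f \<zero>\<^bsub>M\<^esub>"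
    by (rule lin_mapsD(3)[OF assms(3)]) auto
  then show ?thesis using lin_mapsD(1)[OF assms(3)] by simp
qed

lemma lin_maps_diff:
  assumes "module R M" "module R N" "f \<in> lin_maps R M N" "x \<in> carrier M" "y \<in> carrier M"
  shows "f (x \<ominus>\<^bsub>M\<^esub> y) = f x \<ominus>\<^bsub>N\<^esub> f y"
proof -
  interpret M: module R M by fact
  interpret N: module R N by fact
  have "f (x \<ominus>\<^bsub>M\<^esub> y \<oplus>\<^bsub>M\<^esub> y) = f (x \<ominus>\<^bsub>M\<^esub> y) \<oplus>\<^bsub>N\<^esub> f y"
    using assms by (intro lin_mapsD(2)) auto
  moreover have "x \<ominus>\<^bsub>M\<^esub> y \<oplus>\<^bsub>M\<^esub> y = x"
    using assms(4,5) by (simp add: a_minus_def M.M.a_assoc M.M.l_neg)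
  ultimately show ?thesis
    using assms(4,5) lin_mapsD(1)[OF assms(3)]
    by (simp add: a_minus_def N.M.a_assoc N.M.r_neg)
qed

context module
begin

lemma diff_zero_iff:
  "x \<in> carrier M \<Longrightarrow> y \<in> carrier M \<Longrightarrow> x \<ominus>\<^bsub>M\<^esub> y = \<zero>\<^bsub>M\<^esub> \<longleftrightarrow> x = y"
  by (metis M.add.inv_closed M.add.inv_inv M.minus_equality M.r_neg a_minus_def)

lemma submoduleI_smult:
  assumes "H \<subseteq> carrier M" "\<zero>\<^bsub>M\<^esub> \<in> H"
    and "\<And>a b. \<lbrakk>a \<in> H; b \<in> H\<rbrakk> \<Longrightarrow> a \<oplus>\<^bsub>M\<^esub> b \<in> H"
    and smult: "\<And>a x. \<lbrakk>a \<in> carrier R; x \<in> H\<rbrakk> \<Longrightarrow> a \<odot>\<^bsub>M\<^esub> x \<in> H"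
  shows "submodule H R M"
proof (rule submoduleI)
  fix x assume x: "x \<in> H"
  have "(\<ominus> \<one>) \<odot>\<^bsub>M\<^esub> x = \<ominus>\<^bsub>M\<^esub> x"
    using x assms(1) by (subst smult_l_minus) auto
  then show "\<ominus>\<^bsub>M\<^esub> x \<in> H" using smult[of "\<ominus> \<one>" x] x by simp
qed (use assms in auto)

lemma submodule_zero: "submodule H R M \<Longrightarrow> \<zero>\<^bsub>M\<^esub> \<in> H"
  using submoduleE(1,2,4)[of H] smult_l_null by (metis R.zero_closed ex_in_conv subsetD)

lemma submodule_diff: "submodule H R M \<Longrightarrow> x \<in> H \<Longrightarrow> y \<in> H \<Longrightarrow> x \<ominus>\<^bsub>M\<^esub> y \<in> H"
  unfolding a_minus_def by (simp add: submoduleE)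

lemma submodule_module: "submodule H R M \<Longrightarrow> module R (M\<lparr>carrier := H\<rparr>)"
  by (rule submodule.submodule_is_module[OF _ module_axioms])

lemma zero_submodule: "submodule {\<zero>\<^bsub>M\<^esub>} R M"
  by (rule submoduleI_smult) auto

lemma submodule_Union_chain:
  assumes "C \<noteq> {}" and "subset.chain {H. submodule H R M} C"
  shows "submodule (\<Union>C) R M"
proof -
  have sub: "submodule H R M" if "H \<in> C" for H
    using assms(2) that by (auto simp: subset_chain_def)
  show ?thesis
  proof (rule submoduleI_smult)
    show "\<Union>C \<subseteq> carrier M" using sub submoduleE(1) by blast
    show "\<zero>\<^bsub>M\<^esub> \<in> \<Union>C" using assms(1) sub submodule_zero by blast
    show "a \<odot>\<^bsub>M\<^esub> x \<in> \<Union>C" if "a \<in> carrier R" "x \<in> \<Union>C" for a x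
      using that sub submoduleE(4) by blast
    show "x \<oplus>\<^bsub>M\<^esub> y \<in> \<Union>C" if xy: "x \<in> \<Union>C" "y \<in> \<Union>C" for x y
    proof -
      obtain H where H: "H \<in> C" "x \<in> H" "y \<in> H"
        using assms(2) xy by (auto simp: subset_chain_def) blast
      then show ?thesis using submoduleE(5)[OF sub] by blast
    qed
  qed
qed

text \<open>
  Zorn's lemma, with no chain condition on the module. It is applied to properties that pass to
  unions of chains for other reasons, such as finite generation of the ambient module.
\<close>

lemma maximal_submodule:
  assumes "submodule H0 R M" "P H0"
    and "\<And>C. C \<noteq> {} \<Longrightarrow> subset.chain {H. submodule H R M \<and> P H} C \<Longrightarrow> P (\<Union>C)"
  obtains H where "submodule H R M" "P H"
    "\<And>K. submodule K R M \<Longrightarrow> P K \<Longrightarrow> H \<subseteq> K \<Longrightarrow> K = H"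
proof -
  let ?A = "{H. submodule H R M \<and> P H}"
  have "\<exists>H\<in>?A. \<forall>K\<in>?A. H \<subseteq> K \<longrightarrow> K = H"
  proof (rule subset_Zorn_nonempty)
    show "?A \<noteq> {}" using assms(1,2) by blast
    show "\<Union>C \<in> ?A" if C: "C \<noteq> {}" "subset.chain ?A C" for C
    proof -
      have "subset.chain {H. submodule H R M} C"
        using C(2) unfolding subset_chain_def by blast
      then show ?thesis
        using submodule_Union_chain[OF C(1)] assms(3)[OF C] by blast
    qed
  qed
  then show ?thesis using that by blast
qed

lemma submodule_add_cyclic:
  assumes "submodule H R M" "x \<in> carrier M"
  shows "submodule {y \<oplus>\<^bsub>M\<^esub> a \<odot>\<^bsub>M\<^esub> x |y a. y \<in> H \<and> a \<in> carrier R} R M" (is "submodule ?K R M")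
    and "H \<subseteq> {y \<oplus>\<^bsub>M\<^esub> a \<odot>\<^bsub>M\<^esub> x |y a. y \<in> H \<and> a \<in> carrier R}"
    and "x \<in> {y \<oplus>\<^bsub>M\<^esub> a \<odot>\<^bsub>M\<^esub> x |y a. y \<in> H \<and> a \<in> carrier R}"
proof -
  note H = submoduleE[OF assms(1)] submodule_zero[OF assms(1)]
  have HM: "y \<in> carrier M" if "y \<in> H" for y using H(1) that by blast
  show sub: "H \<subseteq> ?K"
  proof
    fix y assume y: "y \<in> H"
    then have "y = y \<oplus>\<^bsub>M\<^esub> \<zero> \<odot>\<^bsub>M\<^esub> x" using assms(2) HM by simp
    then show "y \<in> ?K" using y by blast
  qed
  have "x = \<zero>\<^bsub>M\<^esub> \<oplus>\<^bsub>M\<^esub> \<one> \<odot>\<^bsub>M\<^esub> x" using assms(2) by simp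
  then show "x \<in> ?K" using submodule_zero[OF assms(1)] by blast
  show "submodule ?K R M"
  proof (rule submoduleI_smult)
    show "?K \<subseteq> carrier M" using HM assms(2) by auto
    show "\<zero>\<^bsub>M\<^esub> \<in> ?K" using sub submodule_zero[OF assms(1)] by blast
    show "u \<oplus>\<^bsub>M\<^esub> v \<in> ?K" if uv: "u \<in> ?K" "v \<in> ?K" for u v
    proof -
      obtain y a z b where yz: "u = y \<oplus>\<^bsub>M\<^esub> a \<odot>\<^bsub>M\<^esub> x" "v = z \<oplus>\<^bsub>M\<^esub> b \<odot>\<^bsub>M\<^esub> x"
        "y \<in> H" "z \<in> H" "a \<in> carrier R" "b \<in> carrier R"
        using uv by blast
      then have "u \<oplus>\<^bsub>M\<^esub> v = (y \<oplus>\<^bsub>M\<^esub> z) \<oplus>\<^bsub>M\<^esub> (a \<oplus> b) \<odot>\<^bsub>M\<^esub> x"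
        using HM assms(2) by (simp add: smult_l_distr M.a_ac)
      then show ?thesis using yz H(5) R.a_closed by blast
    qed
    show "c \<odot>\<^bsub>M\<^esub> u \<in> ?K" if cu: "c \<in> carrier R" "u \<in> ?K" for c u
    proof -
      obtain y a where ya: "u = y \<oplus>\<^bsub>M\<^esub> a \<odot>\<^bsub>M\<^esub> x" "y \<in> H" "a \<in> carrier R"
        using cu by blast
      then have "c \<odot>\<^bsub>M\<^esub> u = c \<odot>\<^bsub>M\<^esub> y \<oplus>\<^bsub>M\<^esub> (c \<otimes> a) \<odot>\<^bsub>M\<^esub> x"
        using HM assms(2) cu by (simp add: smult_r_distr smult_assoc1)
      then show ?thesis using ya H(4) cu R.m_closed by blast
    qed
  qed
qed

end

lemma image_submodule:
  assumes "module R M" "module R N" "f \<in> lin_maps R M N"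
  shows "submodule (f ` carrier M) R N"
proof -
  interpret M: module R M by fact
  interpret N: module R N by fact
  note f = lin_mapsD[OF assms(3)]
  show ?thesis
    by (rule N.submoduleI_smult)
       (use f lin_maps_zero[OF assms] in \<open>auto simp: image_iff simp flip: f(2,3) intro: bexI[of _ "\<zero>\<^bsub>M\<^esub>"]\<close>)
qed

lemma vimage_submodule:
  assumes "module R M" "module R N" "f \<in> lin_maps R M N" "submodule H R N"
  shows "submodule {x \<in> carrier M. f x \<in> H} R M"
proof -
  interpret M: module R M by fact
  interpret N: module R N by fact
  note f = lin_mapsD[OF assms(3)]
  show ?thesis
    by (rule M.submoduleI_smult)
       (use f lin_maps_zero[OF assms(1-3)] N.submoduleE[OF assms(4)] N.submodule_zero[OF assms(4)] in auto)
qed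


section \<open>Finite generation over a noetherian ring\<close>

definition submodule_hull :: "('a, 'm) ring_scheme \<Rightarrow> ('a, 'b, 'c) module_scheme \<Rightarrow> 'b set \<Rightarrow> 'b set"
  where "submodule_hull R M A = \<Inter>{H. submodule H R M \<and> A \<subseteq> H}"

context module
begin

lemma submodule_hull_least: "submodule H R M \<Longrightarrow> A \<subseteq> H \<Longrightarrow> submodule_hull R M A \<subseteq> H"
  by (auto simp: submodule_hull_def)

lemma submodule_hull_superset: "A \<subseteq> submodule_hull R M A"
  by (auto simp: submodule_hull_def)

lemma submodule_hull_submodule:
  assumes "A \<subseteq> carrier M"
  shows "submodule (submodule_hull R M A) R M"
proof (rule submoduleI_smult)
  show "submodule_hull R M A \<subseteq> carrier M"
    using assms by (intro submodule_hull_least carrier_is_submodule)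
qed (auto simp: submodule_hull_def submodule_zero submoduleE)

lemma submodule_hull_insert:
  assumes "insert x A \<subseteq> carrier M"
  shows "submodule_hull R M (insert x A) =
    {y \<oplus>\<^bsub>M\<^esub> a \<odot>\<^bsub>M\<^esub> x |y a. y \<in> submodule_hull R M A \<and> a \<in> carrier R}" (is "_ = ?K")
proof
  have A: "A \<subseteq> carrier M" and x: "x \<in> carrier M" using assms by auto
  note K = submodule_add_cyclic[OF submodule_hull_submodule[OF A] x]
  show "submodule_hull R M (insert x A) \<subseteq> ?K"
    using K submodule_hull_superset[of A] by (intro submodule_hull_least) blast+
  note H = submodule_hull_submodule[OF assms]
  have "submodule_hull R M A \<subseteq> submodule_hull R M (insert x A)"
    by (auto simp: submodule_hull_def)
  then show "?K \<subseteq> submodule_hull R M (insert x A)"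
    using submoduleE(4,5)[OF H] submodule_hull_superset[of "insert x A"] by blast
qed

lemma submodule_hull_finsum:
  assumes "finite A" "A \<subseteq> carrier M"
  shows "submodule_hull R M A =
    {x. \<exists>c\<in>A \<rightarrow> carrier R. x = (\<Oplus>\<^bsub>M\<^esub>a\<in>A. c a \<odot>\<^bsub>M\<^esub> a)}"
  using assms
proof (induction A)
  case empty
  have "submodule_hull R M {} = {\<zero>\<^bsub>M\<^esub>}"
    using submodule_hull_least[OF zero_submodule, of "{}"]
      submodule_zero[OF submodule_hull_submodule[of "{}"]] by auto
  then show ?case by auto
next
  case (insert b A)
  have b: "b \<in> carrier M" and A: "A \<subseteq> carrier M" using insert.prems by auto
  have cl: "(\<lambda>a. c a \<odot>\<^bsub>M\<^esub> a) \<in> A \<rightarrow> carrier M" if "c \<in> A \<rightarrow> carrier R" for c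
    using that A by auto
  have split: "(\<Oplus>\<^bsub>M\<^esub>a\<in>insert b A. c a \<odot>\<^bsub>M\<^esub> a) =
      (\<Oplus>\<^bsub>M\<^esub>a\<in>A. c a \<odot>\<^bsub>M\<^esub> a) \<oplus>\<^bsub>M\<^esub> c b \<odot>\<^bsub>M\<^esub> b"
    if c: "c \<in> A \<rightarrow> carrier R" "c b \<in> carrier R" for c
    using insert.hyps cl[OF c(1)] c b by (subst M.finsum_insert) (auto simp: M.a_comm)
  show ?case
    unfolding submodule_hull_insert[OF insert.prems] insert.IH[OF A]
  proof (intro subset_antisym subsetI)
    fix x assume "x \<in> {y \<oplus>\<^bsub>M\<^esub> a \<odot>\<^bsub>M\<^esub> b |y a.
      y \<in> {x. \<exists>c\<in>A \<rightarrow> carrier R. x = (\<Oplus>\<^bsub>M\<^esub>a\<in>A. c a \<odot>\<^bsub>M\<^esub> a)} \<and> a \<in> carrier R}"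
    then obtain c a where c: "c \<in> A \<rightarrow> carrier R" and a: "a \<in> carrier R"
      and x: "x = (\<Oplus>\<^bsub>M\<^esub>a\<in>A. c a \<odot>\<^bsub>M\<^esub> a) \<oplus>\<^bsub>M\<^esub> a \<odot>\<^bsub>M\<^esub> b" by blast
    let ?d = "c(b := a)"
    have d: "?d \<in> insert b A \<rightarrow> carrier R" using c a by auto
    have "(\<Oplus>\<^bsub>M\<^esub>a\<in>A. ?d a \<odot>\<^bsub>M\<^esub> a) = (\<Oplus>\<^bsub>M\<^esub>a\<in>A. c a \<odot>\<^bsub>M\<^esub> a)"
      using insert.hyps cl[OF c] by (intro M.finsum_cong') auto
    then have "x = (\<Oplus>\<^bsub>M\<^esub>a\<in>insert b A. ?d a \<odot>\<^bsub>M\<^esub> a)"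
      using split[of ?d] d x by simp
    then show "x \<in> {x. \<exists>d\<in>insert b A \<rightarrow> carrier R. x = (\<Oplus>\<^bsub>M\<^esub>a\<in>insert b A. d a \<odot>\<^bsub>M\<^esub> a)}"
      using d by blast
  next
    fix x assume "x \<in> {x. \<exists>d\<in>insert b A \<rightarrow> carrier R. x = (\<Oplus>\<^bsub>M\<^esub>a\<in>insert b A. d a \<odot>\<^bsub>M\<^esub> a)}"
    then obtain c where c: "c \<in> A \<rightarrow> carrier R" "c b \<in> carrier R"
      and x: "x = (\<Oplus>\<^bsub>M\<^esub>a\<in>insert b A. c a \<odot>\<^bsub>M\<^esub> a)" by blast
    show "x \<in> {y \<oplus>\<^bsub>M\<^esub> a \<odot>\<^bsub>M\<^esub> b |y a.
      y \<in> {x. \<exists>c\<in>A \<rightarrow> carrier R. x = (\<Oplus>\<^bsub>M\<^esub>a\<in>A. c a \<odot>\<^bsub>M\<^esub> a)} \<and> a \<in> carrier R}"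
      unfolding x split[OF c] using c by blast
  qed
qed

lemma finitely_generated_iff_hull:
  "finitely_generated R M \<longleftrightarrow>
    (\<exists>A. finite A \<and> A \<subseteq> carrier M \<and> submodule_hull R M A = carrier M)"
proof -
  have "(\<forall>x\<in>carrier M. \<exists>c\<in>A \<rightarrow> carrier R. x = (\<Oplus>\<^bsub>M\<^esub>a\<in>A. c a \<odot>\<^bsub>M\<^esub> a)) \<longleftrightarrow>
      submodule_hull R M A = carrier M" if A: "finite A" "A \<subseteq> carrier M" for A
  proof -
    have "submodule_hull R M A = carrier M \<longleftrightarrow> (\<forall>x\<in>carrier M. x \<in> submodule_hull R M A)"
      using submoduleE(1)[OF submodule_hull_submodule[OF A(2)]] by auto
    then show ?thesis unfolding submodule_hull_finsum[OF A] by simp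
  qed
  then show ?thesis
    unfolding finitely_generated_def by (intro iff_exI conj_cong refl)
qed

lemma submodule_of_submodule:
  assumes "submodule K R M" "H \<subseteq> K"
  shows "submodule H R (M\<lparr>carrier := K\<rparr>) \<longleftrightarrow> submodule H R M"
proof -
  interpret K: module R "M\<lparr>carrier := K\<rparr>" by (rule submodule_module[OF assms(1)])
  show ?thesis
  proof
    assume H: "submodule H R (M\<lparr>carrier := K\<rparr>)"
    show "submodule H R M"
      using K.submoduleE[OF H] K.submodule_zero[OF H] submoduleE(1)[OF assms(1)]
      by (intro submoduleI_smult) auto
  next
    assume H: "submodule H R M"
    show "submodule H R (M\<lparr>carrier := K\<rparr>)"
      using submoduleE[OF H] submodule_zero[OF H] assms(2)
      by (intro K.submoduleI_smult) auto
  qed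
qed

lemma finitely_generated_submodule_iff:
  assumes "submodule K R M"
  shows "finitely_generated R (M\<lparr>carrier := K\<rparr>) \<longleftrightarrow>
    (\<exists>A. finite A \<and> A \<subseteq> carrier M \<and> submodule_hull R M A = K)"
proof -
  interpret K: module R "M\<lparr>carrier := K\<rparr>" by (rule submodule_module[OF assms])
  have eq: "submodule_hull R (M\<lparr>carrier := K\<rparr>) A = submodule_hull R M A" if "A \<subseteq> K" for A
  proof
    have AM: "A \<subseteq> carrier M" using that submoduleE(1)[OF assms] by blast
    have "submodule_hull R M A \<subseteq> K" by (rule submodule_hull_least[OF assms that])
    then show "submodule_hull R (M\<lparr>carrier := K\<rparr>) A \<subseteq> submodule_hull R M A"
      using submodule_hull_submodule[OF AM] submodule_hull_superset
      by (intro K.submodule_hull_least) (simp_all add: submodule_of_submodule[OF assms])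
    have K': "submodule_hull R (M\<lparr>carrier := K\<rparr>) A \<subseteq> K"
      using that K.submodule_hull_least[OF K.carrier_is_submodule, of A] by simp
    then show "submodule_hull R M A \<subseteq> submodule_hull R (M\<lparr>carrier := K\<rparr>) A"
      using K.submodule_hull_submodule[of A] K.submodule_hull_superset that
      by (intro submodule_hull_least) (simp_all add: submodule_of_submodule[OF assms])
  qed
  show ?thesis
    unfolding K.finitely_generated_iff_hull
    using eq submoduleE(1)[OF assms] by simp (metis order_trans submodule_hull_superset)
qed

text \<open>
  Induction on the number of generators, as for Hilbert's basis theorem. Elements of \<open>H\<close> have the
  form \<open>y + c x\<close> with \<open>y\<close> in the hull of \<open>A\<close>, and the possible leading coefficients \<open>c\<close> form an
  ideal. Finitely many elements of \<open>H\<close> realise generators of that ideal. Subtracting a combination of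
  them moves any element of \<open>H\<close> into the hull of \<open>A\<close>, where the induction hypothesis applies.
\<close>

lemma submodule_hull_noetherian:
  assumes noeth: "noetherian_ring R"
    and "finite A" "A \<subseteq> carrier M" "submodule H R M" "H \<subseteq> submodule_hull R M A"
  shows "\<exists>B. finite B \<and> B \<subseteq> carrier M \<and> submodule_hull R M B = H"
  using assms(2-)
proof (induction A arbitrary: H)
  case empty
  have "submodule_hull R M {} \<subseteq> {\<zero>\<^bsub>M\<^esub>}"
    by (rule submodule_hull_least[OF zero_submodule]) simp
  then have "submodule_hull R M {} = H"
    using empty.prems submodule_hull_least[OF empty.prems(2), of "{}"] by auto
  then show ?case by (intro exI[of _ "{}"]) simp
next
  case (insert x A)
  interpret N: noetherian_ring R by fact
  note H = submoduleE[OF insert.prems(2)]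
  have A: "A \<subseteq> carrier M" and x: "x \<in> carrier M" using insert.prems by auto
  let ?S = "submodule_hull R M A"
  note S = submodule_hull_submodule[OF A]
  have SM: "?S \<subseteq> carrier M" using submoduleE(1)[OF S] .
  have HM: "y \<in> carrier M" if "y \<in> H" for y using H(1) that by blast
  have lead_ideal: "ideal {c \<in> carrier R. \<exists>y\<in>?S. y \<oplus>\<^bsub>M\<^esub> c \<odot>\<^bsub>M\<^esub> x \<in> K} R" (is "ideal (?I K) R")
    if K: "submodule K R M" for K
  proof (rule idealI)
    show "ring R" by (rule R.ring_axioms)
    show mult: "b \<otimes> a \<in> ?I K" if "a \<in> ?I K" "b \<in> carrier R" for a b
    proof -
      obtain y where y: "y \<in> ?S" "y \<oplus>\<^bsub>M\<^esub> a \<odot>\<^bsub>M\<^esub> x \<in> K" "a \<in> carrier R" using \<open>a \<in> ?I K\<close> by blast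
      have "b \<odot>\<^bsub>M\<^esub> (y \<oplus>\<^bsub>M\<^esub> a \<odot>\<^bsub>M\<^esub> x) = b \<odot>\<^bsub>M\<^esub> y \<oplus>\<^bsub>M\<^esub> (b \<otimes> a) \<odot>\<^bsub>M\<^esub> x"
        using y SM that(2) x by (auto simp: smult_r_distr smult_assoc1)
      then have "b \<odot>\<^bsub>M\<^esub> y \<oplus>\<^bsub>M\<^esub> (b \<otimes> a) \<odot>\<^bsub>M\<^esub> x \<in> K"
        using submoduleE(4)[OF K that(2) y(2)] by simp
      then show ?thesis using submoduleE(4)[OF S that(2) y(1)] y that(2) by auto
    qed
    show "a \<otimes> b \<in> ?I K" if "a \<in> ?I K" "b \<in> carrier R" for a b
      using mult[OF that] that by (simp add: R.m_comm)
    show "subgroup (?I K) (add_monoid R)"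
    proof (rule R.add.subgroupI)
      show "?I K \<subseteq> carrier R" by blast
      have "\<zero>\<^bsub>M\<^esub> \<oplus>\<^bsub>M\<^esub> \<zero> \<odot>\<^bsub>M\<^esub> x \<in> K" using submodule_zero[OF K] x by simp
      then show "?I K \<noteq> {}" using submodule_zero[OF S] by blast
      show "\<ominus> a \<in> ?I K" if "a \<in> ?I K" for a
        using mult[OF that, of "\<ominus> \<one>"] that by (simp add: R.l_minus)
      show "a \<oplus> b \<in> ?I K" if ab: "a \<in> ?I K" "b \<in> ?I K" for a b
      proof -
        obtain y z where yz: "y \<in> ?S" "y \<oplus>\<^bsub>M\<^esub> a \<odot>\<^bsub>M\<^esub> x \<in> K" "a \<in> carrier R"
          "z \<in> ?S" "z \<oplus>\<^bsub>M\<^esub> b \<odot>\<^bsub>M\<^esub> x \<in> K" "b \<in> carrier R" using ab by blast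
        then have yzM: "y \<in> carrier M" "z \<in> carrier M" using SM by auto
        have "(y \<oplus>\<^bsub>M\<^esub> a \<odot>\<^bsub>M\<^esub> x) \<oplus>\<^bsub>M\<^esub> (z \<oplus>\<^bsub>M\<^esub> b \<odot>\<^bsub>M\<^esub> x) = (y \<oplus>\<^bsub>M\<^esub> z) \<oplus>\<^bsub>M\<^esub> (a \<oplus> b) \<odot>\<^bsub>M\<^esub> x"
          using yz yzM x by (simp add: smult_l_distr M.a_ac)
        then have "(y \<oplus>\<^bsub>M\<^esub> z) \<oplus>\<^bsub>M\<^esub> (a \<oplus> b) \<odot>\<^bsub>M\<^esub> x \<in> K"
          using submoduleE(5)[OF K yz(2) yz(5)] by simp
        then show ?thesis using submoduleE(5)[OF S yz(1) yz(4)] yz by auto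
      qed
    qed
  qed
  let ?I = "\<lambda>K. {c \<in> carrier R. \<exists>y\<in>?S. y \<oplus>\<^bsub>M\<^esub> c \<odot>\<^bsub>M\<^esub> x \<in> K}"
  obtain G where G: "G \<subseteq> carrier R" "finite G" "?I H = Idl\<^bsub>R\<^esub> G"
    using N.finetely_gen[OF lead_ideal[OF insert.prems(2)]] by blast
  have "G \<subseteq> ?I H" using R.genideal_self[OF G(1)] G(3) by simp
  then have "\<forall>c\<in>G. \<exists>y. y \<in> ?S \<and> y \<oplus>\<^bsub>M\<^esub> c \<odot>\<^bsub>M\<^esub> x \<in> H" by blast
  then obtain w where w: "\<And>c. c \<in> G \<Longrightarrow> w c \<in> ?S \<and> w c \<oplus>\<^bsub>M\<^esub> c \<odot>\<^bsub>M\<^esub> x \<in> H" by metis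
  have "submodule (H \<inter> ?S) R M"
    using H submoduleE[OF S] submodule_zero[OF S] submodule_zero[OF insert.prems(2)]
    by (intro submoduleI_smult) auto
  then obtain B where B: "finite B" "B \<subseteq> carrier M" "submodule_hull R M B = H \<inter> ?S"
    using insert.IH[OF A, of "H \<inter> ?S"] by auto
  let ?W = "(\<lambda>c. w c \<oplus>\<^bsub>M\<^esub> c \<odot>\<^bsub>M\<^esub> x) ` G"
  let ?K = "submodule_hull R M (B \<union> ?W)"
  have WM: "B \<union> ?W \<subseteq> carrier M" using B(2) w HM by auto
  note K = submodule_hull_submodule[OF WM]
  have BH: "B \<subseteq> H" using B(3) submodule_hull_superset[of B] by blast
  have KH: "?K \<subseteq> H" using BH w by (intro submodule_hull_least[OF insert.prems(2)]) auto
  have "submodule_hull R M B \<subseteq> ?K" by (auto simp: submodule_hull_def)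
  then have HS: "H \<inter> ?S \<subseteq> ?K" using B(3) by simp
  have "G \<subseteq> ?I ?K"
    using w G(1) submodule_hull_superset[of "B \<union> ?W"] by blast
  then have "Idl\<^bsub>R\<^esub> G \<subseteq> ?I ?K" by (rule R.genideal_minimal[OF lead_ideal[OF K]])
  then have lead: "?I H \<subseteq> ?I ?K" using G(3) by simp
  have "H \<subseteq> ?K"
  proof
    fix h assume h: "h \<in> H"
    then have "h \<in> submodule_hull R M (insert x A)" using insert.prems(3) by blast
    then obtain y a where ya: "h = y \<oplus>\<^bsub>M\<^esub> a \<odot>\<^bsub>M\<^esub> x" "y \<in> ?S" "a \<in> carrier R"
      unfolding submodule_hull_insert[OF insert.prems(1)] by blast
    then have "a \<in> ?I H" using h by blast
    then obtain z where z: "z \<in> ?S" "z \<oplus>\<^bsub>M\<^esub> a \<odot>\<^bsub>M\<^esub> x \<in> ?K" using lead by blast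
    have M: "y \<in> carrier M" "z \<in> carrier M" "a \<odot>\<^bsub>M\<^esub> x \<in> carrier M" using ya z SM x by auto
    have "h \<ominus>\<^bsub>M\<^esub> (z \<oplus>\<^bsub>M\<^esub> a \<odot>\<^bsub>M\<^esub> x) = y \<ominus>\<^bsub>M\<^esub> z"
      using M unfolding ya(1) a_minus_def by (simp add: M.minus_add M.a_ac M.r_neg M.r_neg1 M.r_neg2)
    then have "y \<ominus>\<^bsub>M\<^esub> z \<in> H \<inter> ?S"
      using submodule_diff[OF insert.prems(2) h subsetD[OF KH z(2)]] submodule_diff[OF S ya(2) z(1)]
      by simp
    then have "y \<ominus>\<^bsub>M\<^esub> z \<in> ?K" using HS by blast
    then have "(y \<ominus>\<^bsub>M\<^esub> z) \<oplus>\<^bsub>M\<^esub> (z \<oplus>\<^bsub>M\<^esub> a \<odot>\<^bsub>M\<^esub> x) \<in> ?K" using submoduleE(5)[OF K] z(2) by blast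
    also have "(y \<ominus>\<^bsub>M\<^esub> z) \<oplus>\<^bsub>M\<^esub> (z \<oplus>\<^bsub>M\<^esub> a \<odot>\<^bsub>M\<^esub> x) = h"
      using M unfolding ya(1) a_minus_def by (simp add: M.a_ac M.r_neg M.r_neg1 M.r_neg2)
    finally show "h \<in> ?K" .
  qed
  then show ?case using KH B(1) G(2) WM by (intro exI[of _ "B \<union> ?W"]) auto
qed

lemma submodule_finitely_generated:
  assumes "noetherian_ring R" "finitely_generated R M" "submodule H R M"
  shows "finitely_generated R (M\<lparr>carrier := H\<rparr>)"
proof -
  obtain A where "finite A" "A \<subseteq> carrier M" "submodule_hull R M A = carrier M"
    using assms(2) finitely_generated_iff_hull by blast
  then show ?thesis
    using submodule_hull_noetherian[OF assms(1), of A H] assms(3) submoduleE(1)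
    by (simp add: finitely_generated_submodule_iff)
qed

end

lemma finitely_generated_image:
  assumes "module R M" "module R N" "f \<in> lin_maps R M N" "f ` carrier M = carrier N"
    and "finitely_generated R M"
  shows "finitely_generated R N"
proof -
  interpret M: module R M by fact
  interpret N: module R N by fact
  obtain A where A: "finite A" "A \<subseteq> carrier M" "submodule_hull R M A = carrier M"
    using assms(5) M.finitely_generated_iff_hull by blast
  have fA: "f ` A \<subseteq> carrier N" using A(2) lin_mapsD(1)[OF assms(3)] by auto
  let ?H = "submodule_hull R N (f ` A)"
  have "submodule_hull R M A \<subseteq> {x \<in> carrier M. f x \<in> ?H}"
    using A(2) N.submodule_hull_superset[of "f ` A"]
    by (intro M.submodule_hull_least vimage_submodule[OF assms(1-3)] N.submodule_hull_submodule fA) auto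
  then have "carrier N \<subseteq> ?H" using A(3) unfolding assms(4)[symmetric] by blast
  then show ?thesis
    using fA A(1) N.finitely_generated_iff_hull N.submoduleE(1)[OF N.submodule_hull_submodule[OF fA]]
    by blast
qed


section \<open>Quotient modules\<close>

lemma (in module) smult_diff:
  "a \<in> carrier R \<Longrightarrow> x \<in> carrier M \<Longrightarrow> y \<in> carrier M \<Longrightarrow>
    a \<odot>\<^bsub>M\<^esub> (x \<ominus>\<^bsub>M\<^esub> y) = a \<odot>\<^bsub>M\<^esub> x \<ominus>\<^bsub>M\<^esub> a \<odot>\<^bsub>M\<^esub> y"
  by (simp add: a_minus_def smult_r_distr smult_r_minus)

text \<open>
  \<^const>\<open>transport\<close> along a map that is not injective still makes sense: its operations compute on
  representatives chosen by \<^const>\<open>inv_into\<close>. If the map identifies exactly the elements that are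
  congruent modulo \<open>H\<close>, the choice does not matter and the result is the quotient by \<open>H\<close>.
\<close>

lemma transport_quotient:
  assumes "module R M" "submodule H R M"
    and cong: "\<forall>x\<in>carrier M. \<forall>y\<in>carrier M. e x = e y \<longleftrightarrow> x \<ominus>\<^bsub>M\<^esub> y \<in> H"
  shows "module R (transport e M)" and "e \<in> lin_maps R M (transport e M)"
    and "e ` carrier M = carrier (transport e M)"
    and "x \<in> carrier M \<Longrightarrow> e x = \<zero>\<^bsub>transport e M\<^esub> \<longleftrightarrow> x \<in> H"
proof -
  interpret module R M by fact
  let ?N = "transport e M"
  let ?d = "inv_into (carrier M) e"
  note H = submoduleE[OF assms(2)]
  have carr: "carrier ?N = e ` carrier M" and zero: "\<zero>\<^bsub>?N\<^esub> = e \<zero>\<^bsub>M\<^esub>"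
    by (simp_all add: transport_def Let_def)
  have d: "?d (e x) \<in> carrier M" "?d (e x) \<ominus>\<^bsub>M\<^esub> x \<in> H" if "x \<in> carrier M" for x
  proof -
    show "?d (e x) \<in> carrier M" using that by (intro inv_into_into) auto
    then show "?d (e x) \<ominus>\<^bsub>M\<^esub> x \<in> H" using that cong by (simp add: f_inv_into_f flip: cong)
  qed
  have add: "e x \<oplus>\<^bsub>?N\<^esub> e y = e (x \<oplus>\<^bsub>M\<^esub> y)" if xy: "x \<in> carrier M" "y \<in> carrier M" for x y
  proof -
    have "(?d (e x) \<oplus>\<^bsub>M\<^esub> ?d (e y)) \<ominus>\<^bsub>M\<^esub> (x \<oplus>\<^bsub>M\<^esub> y) =
        (?d (e x) \<ominus>\<^bsub>M\<^esub> x) \<oplus>\<^bsub>M\<^esub> (?d (e y) \<ominus>\<^bsub>M\<^esub> y)"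
      using xy d(1) by (simp add: a_minus_def M.minus_add M.a_ac)
    then have "(?d (e x) \<oplus>\<^bsub>M\<^esub> ?d (e y)) \<ominus>\<^bsub>M\<^esub> (x \<oplus>\<^bsub>M\<^esub> y) \<in> H"
      using d(2) xy H(5) by simp
    then show ?thesis using xy d(1) cong by (simp add: transport_def Let_def)
  qed
  have smult: "a \<odot>\<^bsub>?N\<^esub> e x = e (a \<odot>\<^bsub>M\<^esub> x)" if ax: "a \<in> carrier R" "x \<in> carrier M" for a x
  proof -
    have "a \<odot>\<^bsub>M\<^esub> ?d (e x) \<ominus>\<^bsub>M\<^esub> a \<odot>\<^bsub>M\<^esub> x \<in> H"
      using H(4)[OF ax(1) d(2)[OF ax(2)]] ax d(1) by (simp add: smult_diff)
    then show ?thesis using ax d(1) cong by (simp add: transport_def Let_def)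
  qed
  have ab: "abelian_group ?N"
  proof (rule abelian_groupI; unfold carr zero)
    fix x assume "x \<in> e ` carrier M"
    then obtain u where u: "u \<in> carrier M" "x = e u" by blast
    then show "\<exists>y\<in>e ` carrier M. y \<oplus>\<^bsub>?N\<^esub> x = e \<zero>\<^bsub>M\<^esub>"
      by (intro bexI[of _ "e (\<ominus>\<^bsub>M\<^esub> u)"]) (simp_all add: add M.l_neg)
    show "e \<zero>\<^bsub>M\<^esub> \<oplus>\<^bsub>?N\<^esub> x = x" using u by (simp add: add)
    fix y assume "y \<in> e ` carrier M"
    then obtain v where v: "v \<in> carrier M" "y = e v" by blast
    show "x \<oplus>\<^bsub>?N\<^esub> y \<in> e ` carrier M" using u v by (simp add: add)
    show "x \<oplus>\<^bsub>?N\<^esub> y = y \<oplus>\<^bsub>?N\<^esub> x" using u v by (simp add: add M.a_comm)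
    fix z assume "z \<in> e ` carrier M"
    then obtain w where w: "w \<in> carrier M" "z = e w" by blast
    show "x \<oplus>\<^bsub>?N\<^esub> y \<oplus>\<^bsub>?N\<^esub> z = x \<oplus>\<^bsub>?N\<^esub> (y \<oplus>\<^bsub>?N\<^esub> z)"
      using u v w by (simp add: add M.a_assoc)
  qed simp
  show "module R ?N"
    by (rule moduleI[OF R.is_cring ab]; unfold carr; elim imageE; hypsubst)
       (simp_all add: add smult smult_l_distr smult_r_distr smult_assoc1)
  show "e \<in> lin_maps R M ?N"
    by (rule lin_mapsI) (simp_all add: carr add smult)
  show "e ` carrier M = carrier ?N" by (simp add: carr)
  have "\<ominus>\<^bsub>M\<^esub> \<zero>\<^bsub>M\<^esub> = \<zero>\<^bsub>M\<^esub>" by (metis M.l_zero M.minus_equality M.zero_closed)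
  then have "x \<ominus>\<^bsub>M\<^esub> \<zero>\<^bsub>M\<^esub> = x" if "x \<in> carrier M" for x
    using that by (simp only: a_minus_def M.r_zero)
  then show "e x = \<zero>\<^bsub>?N\<^esub> \<longleftrightarrow> x \<in> H" if "x \<in> carrier M"
    using that cong by (simp add: zero)
qed

lemma quotient_in_mod_cat:
  assumes "module R M" "finitely_generated R M" "submodule H R M"
  obtains Q g where "Q \<in> mod_cat R" "g \<in> lin_maps R M Q" "g ` carrier M = carrier Q"
    "\<And>x. x \<in> carrier M \<Longrightarrow> g x = \<zero>\<^bsub>Q\<^esub> \<longleftrightarrow> x \<in> H"
proof -
  interpret module R M by fact
  define e where "e x = {y \<in> carrier M. y \<ominus>\<^bsub>M\<^esub> x \<in> H}" for x
  note H = submoduleE[OF assms(3)]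
  have cong: "e x = e y \<longleftrightarrow> x \<ominus>\<^bsub>M\<^esub> y \<in> H" if xy: "x \<in> carrier M" "y \<in> carrier M" for x y
  proof
    assume "e x = e y"
    moreover have "x \<in> e x"
      using xy submodule_zero[OF assms(3)] by (simp add: e_def diff_zero_iff[THEN iffD2])
    ultimately show "x \<ominus>\<^bsub>M\<^esub> y \<in> H" by (simp add: e_def)
  next
    assume xyH: "x \<ominus>\<^bsub>M\<^esub> y \<in> H"
    have "z \<ominus>\<^bsub>M\<^esub> x \<in> H \<longleftrightarrow> z \<ominus>\<^bsub>M\<^esub> y \<in> H" if z: "z \<in> carrier M" for z
    proof
      have eq: "z \<ominus>\<^bsub>M\<^esub> y = (z \<ominus>\<^bsub>M\<^esub> x) \<oplus>\<^bsub>M\<^esub> (x \<ominus>\<^bsub>M\<^esub> y)"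
        using xy z by (simp add: a_minus_def M.a_assoc M.r_neg1)
      show "z \<ominus>\<^bsub>M\<^esub> y \<in> H" if "z \<ominus>\<^bsub>M\<^esub> x \<in> H"
        unfolding eq using H(5) that xyH by blast
      have "z \<ominus>\<^bsub>M\<^esub> x = (z \<ominus>\<^bsub>M\<^esub> y) \<ominus>\<^bsub>M\<^esub> (x \<ominus>\<^bsub>M\<^esub> y)"
        unfolding eq using xy z by (metis M.a_assoc M.minus_closed M.r_neg M.r_zero a_minus_def M.a_inv_closed)
      then show "z \<ominus>\<^bsub>M\<^esub> x \<in> H" if "z \<ominus>\<^bsub>M\<^esub> y \<in> H"
        using submodule_diff[OF assms(3) that xyH] by simp
    qed
    then show "e x = e y" by (auto simp: e_def)
  qed
  then have "\<forall>x\<in>carrier M. \<forall>y\<in>carrier M. e x = e y \<longleftrightarrow> x \<ominus>\<^bsub>M\<^esub> y \<in> H" by blast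
  note Q = transport_quotient[OF assms(1,3) this]
  have "finitely_generated R (transport e M)"
    by (rule finitely_generated_image[OF assms(1) Q(1-3) assms(2)])
  then obtain N where N: "N \<in> mod_cat R" "lin_iso R (transport e M) N"
    using mod_cat_representative[OF Q(1)] by blast
  then obtain f where f: "f \<in> lin_maps R (transport e M) N"
    "bij_betw f (carrier (transport e M)) (carrier N)"
    unfolding lin_iso_def by blast
  interpret Q: module R "transport e M" by (rule Q(1))
  have modN: "module R N" using N(1) by (simp add: mod_cat_def)
  have f0: "f u = \<zero>\<^bsub>N\<^esub> \<longleftrightarrow> u = \<zero>\<^bsub>transport e M\<^esub>" if "u \<in> carrier (transport e M)" for u
    using lin_maps_zero[OF Q(1) modN f(1)] bij_betw_imp_inj_on[OF f(2)] that
    by (metis Q.M.zero_closed inj_onD)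
  show ?thesis
  proof (rule that[OF N(1) lin_maps_comp[OF Q(2) f(1)]])
    show "(\<lambda>x. f (e x)) ` carrier M = carrier N"
      using Q(3) bij_betw_imp_surj_on[OF f(2)] by (metis image_image)
    show "f (e x) = \<zero>\<^bsub>N\<^esub> \<longleftrightarrow> x \<in> H" if "x \<in> carrier M" for x
      using f0[of "e x"] Q(4)[OF that] lin_mapsD(1)[OF Q(2) that] by simp
  qed
qed


section \<open>Associated primes\<close>

lemma SpecD:
  assumes "p \<in> Spec R"
  shows "ideal p R" and "p \<subseteq> carrier R" and "\<one>\<^bsub>R\<^esub> \<notin> p"
    and "a \<in> carrier R \<Longrightarrow> b \<in> carrier R \<Longrightarrow> a \<otimes>\<^bsub>R\<^esub> b \<in> p \<longleftrightarrow> a \<in> p \<or> b \<in> p"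
proof -
  interpret primeideal p R using assms by (simp add: Spec_def)
  show "ideal p R" by (rule is_ideal)
  show "p \<subseteq> carrier R" using Icarr by blast
  show "\<one>\<^bsub>R\<^esub> \<notin> p" using one_imp_carrier I_notcarr by blast
  show "a \<in> carrier R \<Longrightarrow> b \<in> carrier R \<Longrightarrow> a \<otimes>\<^bsub>R\<^esub> b \<in> p \<longleftrightarrow> a \<in> p \<or> b \<in> p"
    using I_prime I_l_closed I_r_closed by blast
qed

lemma AssE:
  assumes "p \<in> Ass R M"
  obtains x where "p \<in> Spec R" "x \<in> carrier M" "annihilator R M x = p"
  using assms by (auto simp: Ass_def)

lemma annihilator_restrict [simp]:
  "annihilator R (M\<lparr>carrier := H\<rparr>) x = annihilator R M x"
  by (simp add: annihilator_def)

lemma Ass_restrict_subset: "H \<subseteq> carrier M \<Longrightarrow> Ass R (M\<lparr>carrier := H\<rparr>) \<subseteq> Ass R M"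
  by (auto simp: Ass_def)

lemma annihilator_lin_map:
  assumes "module R M" "module R N" "f \<in> lin_maps R M N" "x \<in> carrier M"
  shows "annihilator R M x \<subseteq> annihilator R N (f x)"
    and "(\<And>y. y \<in> carrier M \<Longrightarrow> f y = \<zero>\<^bsub>N\<^esub> \<Longrightarrow> y = \<zero>\<^bsub>M\<^esub>) \<Longrightarrow>
      annihilator R N (f x) = annihilator R M x"
proof -
  interpret M: module R M by fact
  have eq: "a \<odot>\<^bsub>N\<^esub> f x = f (a \<odot>\<^bsub>M\<^esub> x)" if "a \<in> carrier R" for a
    using that lin_mapsD(3)[OF assms(3)] assms(4) by simp
  note f0 = lin_maps_zero[OF assms(1-3)]
  show "annihilator R M x \<subseteq> annihilator R N (f x)"
    using eq f0 by (auto simp: annihilator_def)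
  show "annihilator R N (f x) = annihilator R M x"
    if "\<And>y. y \<in> carrier M \<Longrightarrow> f y = \<zero>\<^bsub>N\<^esub> \<Longrightarrow> y = \<zero>\<^bsub>M\<^esub>"
    using eq f0 that assms(4) by (auto simp: annihilator_def)
qed

lemma Ass_injective:
  assumes "module R M" "module R N" "f \<in> lin_maps R M N"
    and "\<And>y. y \<in> carrier M \<Longrightarrow> f y = \<zero>\<^bsub>N\<^esub> \<Longrightarrow> y = \<zero>\<^bsub>M\<^esub>"
  shows "Ass R M \<subseteq> Ass R N"
proof
  fix p assume "p \<in> Ass R M"
  then obtain x where x: "p \<in> Spec R" "x \<in> carrier M" "annihilator R M x = p" by (rule AssE)
  then have "annihilator R N (f x) = p" using annihilator_lin_map(2)[OF assms(1-3)] assms(4) by blast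
  then show "p \<in> Ass R N" using x lin_mapsD(1)[OF assms(3)] by (auto simp: Ass_def)
qed

lemma lin_iso_sym:
  assumes "module R M" "lin_iso R M N"
  shows "lin_iso R N M"
proof -
  interpret module R M by fact
  obtain f where f: "f \<in> lin_maps R M N" "bij_betw f (carrier M) (carrier N)"
    using assms(2) by (auto simp: lin_iso_def)
  let ?g = "inv_into (carrier M) f"
  have g: "?g u \<in> carrier M" "f (?g u) = u" if "u \<in> carrier N" for u
    using f(2) that bij_betw_inv_into_right[OF f(2)] bij_betwE[OF bij_betw_inv_into[OF f(2)]] by auto
  have gf: "?g (f x) = x" if "x \<in> carrier M" for x
    using f(2) that by (rule bij_betw_inv_into_left)
  have "?g \<in> lin_maps R N M"
  proof (rule lin_mapsI)
    show "?g (u \<oplus>\<^bsub>N\<^esub> v) = ?g u \<oplus>\<^bsub>M\<^esub> ?g v" if "u \<in> carrier N" "v \<in> carrier N" for u v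
      using lin_mapsD(2)[OF f(1) g(1)[OF that(1)] g(1)[OF that(2)]] gf[of "?g u \<oplus>\<^bsub>M\<^esub> ?g v"] g that by simp
    show "?g (a \<odot>\<^bsub>N\<^esub> u) = a \<odot>\<^bsub>M\<^esub> ?g u" if "a \<in> carrier R" "u \<in> carrier N" for a u
      using lin_mapsD(3)[OF f(1) that(1) g(1)[OF that(2)]] gf[of "a \<odot>\<^bsub>M\<^esub> ?g u"] g that by simp
  qed (rule g)
  then show ?thesis using bij_betw_inv_into[OF f(2)] by (auto simp: lin_iso_def)
qed

text \<open>
  Stated separately from \<open>Ass_lin_iso\<close> because that proof uses it in both directions, hence for
  two different element types of the source.
\<close>

lemma Ass_lin_iso_subset:
  assumes "module R M" "module R N" "lin_iso R M N"
  shows "Ass R M \<subseteq> Ass R N"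
proof -
  obtain f where f: "f \<in> lin_maps R M N" "bij_betw f (carrier M) (carrier N)"
    using assms(3) by (auto simp: lin_iso_def)
  interpret M: module R M by (rule assms(1))
  show ?thesis
    using lin_maps_zero[OF assms(1,2) f(1)] bij_betw_imp_inj_on[OF f(2)]
    by (intro Ass_injective[OF assms(1,2) f(1)]) (metis M.M.zero_closed inj_onD)
qed

lemma Ass_lin_iso:
  assumes "module R M" "module R N" "lin_iso R M N"
  shows "Ass R N = Ass R M"
proof -
  show ?thesis
    using Ass_lin_iso_subset[OF assms] Ass_lin_iso_subset[OF assms(2,1) lin_iso_sym[OF assms(1,3)]]
    by blast
qed

context module
begin

lemma annihilator_ideal:
  assumes "x \<in> carrier M"
  shows "ideal (annihilator R M x) R"
proof (rule idealI)
  show "ring R" by (rule R.ring_axioms)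
  show mult: "b \<otimes> a \<in> annihilator R M x" if "a \<in> annihilator R M x" "b \<in> carrier R" for a b
    using that assms by (simp add: annihilator_def smult_assoc1)
  show "a \<otimes> b \<in> annihilator R M x" if "a \<in> annihilator R M x" "b \<in> carrier R" for a b
    using mult[OF that] that by (simp add: annihilator_def R.m_comm)
  show "subgroup (annihilator R M x) (add_monoid R)"
  proof (rule R.add.subgroupI)
    show "annihilator R M x \<noteq> {}" using assms smult_l_null by (auto simp: annihilator_def)
  qed (use assms in \<open>auto simp: annihilator_def smult_l_distr smult_l_minus\<close>)
qed

lemma annihilator_smult:
  assumes "x \<in> carrier M" "b \<in> carrier R"
  shows "annihilator R M (b \<odot>\<^bsub>M\<^esub> x) = {a \<in> carrier R. a \<otimes> b \<in> annihilator R M x}"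
  using assms by (auto simp: annihilator_def smult_assoc1)

lemma annihilator_smult_prime:
  assumes "x \<in> carrier M" "annihilator R M x = p" "p \<in> Spec R" "b \<in> carrier R" "b \<notin> p"
  shows "annihilator R M (b \<odot>\<^bsub>M\<^esub> x) = p"
  using annihilator_smult[OF assms(1,4)] SpecD(2,4)[OF assms(3)] assms by auto

text \<open>
  Among the annihilators of elements that miss the multiplicative set \<open>S\<close>, a maximal one is prime:
  if \<open>c d\<close> kills \<open>y\<close> but neither \<open>c\<close> nor \<open>d\<close> does, then the annihilators of \<open>d y\<close> and \<open>c y\<close> are
  strictly larger, so by maximality they contain elements \<open>s\<close> and \<open>t\<close> of \<open>S\<close>. The element \<open>s t y\<close> is then killed by
  \<open>c\<close> and \<open>d\<close>, while its annihilator misses \<open>S\<close>, again against maximality. With \<open>S = {1}\<close> this gives an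
  associated prime of any nonzero module, with \<open>S\<close> the complement of a prime \<open>p\<close> an associated prime
  below \<open>p\<close>, and with \<open>S\<close> the powers of \<open>a\<close> a prime that avoids \<open>a\<close>.
\<close>

lemma exists_associated_prime_disjoint:
  assumes "noetherian_ring R"
    and S: "S \<subseteq> carrier R" "\<one> \<in> S" "\<And>s t. s \<in> S \<Longrightarrow> t \<in> S \<Longrightarrow> s \<otimes> t \<in> S"
    and x: "x \<in> carrier M" "annihilator R M x \<inter> S = {}"
  obtains q where "q \<in> Ass R M" "q \<inter> S = {}"
proof -
  interpret N: noetherian_ring R by fact
  let ?F = "{annihilator R M y |y. y \<in> carrier M \<and> annihilator R M y \<inter> S = {}}"
  have "\<exists>q\<in>?F. \<forall>I\<in>?F. q \<subseteq> I \<longrightarrow> I = q"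
  proof (rule subset_Zorn_nonempty)
    show "?F \<noteq> {}" using x by blast
    fix C assume C: "C \<noteq> {}" "subset.chain ?F C"
    then have "subset.chain {I. ideal I R} C"
      using annihilator_ideal unfolding subset_chain_def by blast
    then show "\<Union>C \<in> ?F"
      using N.ideal_chain_is_trivial[OF C(1)] C(2) unfolding subset_chain_def by blast
  qed
  then obtain q where qF: "q \<in> ?F" and qmax: "\<forall>I\<in>?F. q \<subseteq> I \<longrightarrow> I = q" ..
  from qF obtain y where y: "y \<in> carrier M" "annihilator R M y \<inter> S = {}"
    and qy: "q = annihilator R M y" by auto
  let ?q = "annihilator R M y"
  have max: "annihilator R M z = ?q"
    if "z \<in> carrier M" "annihilator R M z \<inter> S = {}" "?q \<subseteq> annihilator R M z" for z
  proof -
    have "annihilator R M z \<in> ?F" using that(1,2) by auto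
    then show ?thesis using qmax that(3) qy by simp
  qed
  have q: "ideal ?q R" by (rule annihilator_ideal[OF y(1)])
  have grow: "\<exists>s\<in>S. s \<otimes> d \<in> ?q"
    if "c \<in> carrier R" "d \<in> carrier R" "c \<otimes> d \<in> ?q" "c \<notin> ?q" for c d
  proof (rule ccontr)
    assume "\<not> (\<exists>s\<in>S. s \<otimes> d \<in> ?q)"
    then have "annihilator R M (d \<odot>\<^bsub>M\<^esub> y) \<inter> S = {}"
      using annihilator_smult[OF y(1) that(2)] by auto
    moreover have "?q \<subseteq> annihilator R M (d \<odot>\<^bsub>M\<^esub> y)"
      using annihilator_smult[OF y(1) that(2)] ideal.I_r_closed[OF q _ that(2)] ideal.Icarr[OF q] by auto
    ultimately have "annihilator R M (d \<odot>\<^bsub>M\<^esub> y) = ?q" using max y(1) that(2) by simp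
    then show False using annihilator_smult[OF y(1) that(2)] that by auto
  qed
  have "?q \<in> Spec R"
    unfolding Spec_def mem_Collect_eq
  proof (rule primeidealI[OF q R.is_cring])
    show "carrier R \<noteq> ?q" using y(2) S(1,2) by blast
    fix c d assume cd: "c \<in> carrier R" "d \<in> carrier R" "c \<otimes> d \<in> ?q"
    show "c \<in> ?q \<or> d \<in> ?q"
    proof (rule ccontr)
      assume no: "\<not> ?thesis"
      obtain s where s: "s \<in> S" "s \<otimes> d \<in> ?q" using grow cd no by blast
      obtain t where t: "t \<in> S" "t \<otimes> c \<in> ?q"
        using grow[of d c] cd no by (auto simp: R.m_comm)
      have st: "s \<in> carrier R" "t \<in> carrier R" using s t S(1) by auto
      let ?z = "(s \<otimes> t) \<odot>\<^bsub>M\<^esub> y"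
      have annz: "annihilator R M ?z = {a \<in> carrier R. a \<otimes> (s \<otimes> t) \<in> ?q}"
        using annihilator_smult[OF y(1)] st by simp
      have "annihilator R M ?z \<inter> S = {}" using annz y(2) S(3) s(1) t(1) by auto
      moreover have "?q \<subseteq> annihilator R M ?z"
        using annz ideal.I_r_closed[OF q, of _ "s \<otimes> t"] ideal.Icarr[OF q] st by auto
      ultimately have "annihilator R M ?z = ?q" using max y(1) st by simp
      moreover have "c \<otimes> (s \<otimes> t) = s \<otimes> (t \<otimes> c)" using st cd by (simp add: R.m_ac)
      then have "c \<in> annihilator R M ?z"
        using annz cd ideal.I_l_closed[OF q t(2) st(1)] by simp
      ultimately show False using no by blast
    qed
  qed
  then show ?thesis using that y by (auto simp: Ass_def)
qed

lemma Ass_nonempty: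
  assumes "noetherian_ring R" "x \<in> carrier M" "x \<noteq> \<zero>\<^bsub>M\<^esub>"
  shows "Ass R M \<noteq> {}"
  by (rule exists_associated_prime_disjoint[of "{\<one>}" x]) (use assms in \<open>auto simp: annihilator_def\<close>)

lemma exists_prime_annihilator_in_submodule:
  assumes "noetherian_ring R" "submodule H R M" "x \<in> H" "x \<noteq> \<zero>\<^bsub>M\<^esub>"
  obtains p y where "p \<in> Spec R" "y \<in> H" "annihilator R M y = p"
proof -
  interpret H: module R "M\<lparr>carrier := H\<rparr>" by (rule submodule_module[OF assms(2)])
  have "Ass R (M\<lparr>carrier := H\<rparr>) \<noteq> {}" using H.Ass_nonempty[OF assms(1), of x] assms(3,4) by simp
  then show ?thesis using that by (auto simp: Ass_def)
qed

end


section \<open>Homomorphisms between finitely generated modules\<close>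

lemma (in module) submodule_colon:
  assumes "submodule H R M" "a \<in> carrier R"
  shows "submodule {x \<in> carrier M. a \<odot>\<^bsub>M\<^esub> x \<in> H} R M"
proof (rule submoduleI_smult)
  fix b x assume b: "b \<in> carrier R" and "x \<in> {x \<in> carrier M. a \<odot>\<^bsub>M\<^esub> x \<in> H}"
  then have x: "x \<in> carrier M" "b \<odot>\<^bsub>M\<^esub> (a \<odot>\<^bsub>M\<^esub> x) \<in> H"
    using submoduleE(4)[OF assms(1)] by auto
  then have "a \<odot>\<^bsub>M\<^esub> (b \<odot>\<^bsub>M\<^esub> x) \<in> H"
    using assms(2) b by (simp add: R.m_comm flip: smult_assoc1)
  then show "b \<odot>\<^bsub>M\<^esub> x \<in> {x \<in> carrier M. a \<odot>\<^bsub>M\<^esub> x \<in> H}" using x b by simp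
qed (use assms submoduleE[OF assms(1)] submodule_zero[OF assms(1)] in \<open>auto simp: smult_r_distr\<close>)

text \<open>
  The existence half of the criterion, without localization: \<open>p\<close> contains the annihilator of \<open>M\<close>,
  and \<open>N\<close> contains a copy of \<open>R/p\<close> generated by \<open>m\<close>, so a nonzero map from \<open>M\<close> to \<open>R/p\<close> suffices. Take a
  submodule \<open>K\<close> maximal with the property that \<open>p\<close> contains the annihilator of \<open>M/K\<close>. Then for every
  nonzero \<open>x\<close> in \<open>M/K\<close> some \<open>s\<close> outside \<open>p\<close> maps \<open>M/K\<close> into \<open>R x\<close>. It follows that elements
  outside \<open>p\<close> act injectively on \<open>M/K\<close> and that \<open>p\<close> kills it. So \<open>R x\<close> is a copy of \<open>R/p\<close>, and
  multiplication by \<open>s\<close> is the desired map.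
\<close>

lemma (in module) Hom_nonzero:
  assumes fg: "finitely_generated R M" and p: "p \<in> Spec R"
    and ann: "\<And>a. a \<in> carrier R \<Longrightarrow> (\<And>x. x \<in> carrier M \<Longrightarrow> a \<odot>\<^bsub>M\<^esub> x = \<zero>\<^bsub>M\<^esub>) \<Longrightarrow> a \<in> p"
    and N: "module R N" "m \<in> carrier N" "annihilator R N m = p"
  shows "\<not> Hom_zero R M N"
proof -
  interpret N: module R N by fact
  note pD = SpecD[OF p]
  interpret p: ideal p R by (rule pD(1))
  obtain A where A: "finite A" "A \<subseteq> carrier M" "submodule_hull R M A = carrier M"
    using fg finitely_generated_iff_hull by blast
  define P where "P K \<longleftrightarrow> (\<forall>a\<in>carrier R. (\<forall>x\<in>carrier M. a \<odot>\<^bsub>M\<^esub> x \<in> K) \<longrightarrow> a \<in> p)" for K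
  \<comment> \<open>Unions of chains preserve P: if a maps the finite generating set A into the union, then it maps
    A into one member H of the chain, hence all of M.\<close>
  obtain K where K: "submodule K R M" "P K"
    and max: "\<And>L. submodule L R M \<Longrightarrow> P L \<Longrightarrow> K \<subseteq> L \<Longrightarrow> L = K"
  proof (rule maximal_submodule[OF zero_submodule, of P])
    show "P {\<zero>\<^bsub>M\<^esub>}" using ann by (auto simp: P_def)
    fix C assume C: "C \<noteq> {}" "subset.chain {H. submodule H R M \<and> P H} C"
    show "P (\<Union>C)"
      unfolding P_def
    proof (intro ballI impI)
      fix a assume a: "a \<in> carrier R" "\<forall>x\<in>carrier M. a \<odot>\<^bsub>M\<^esub> x \<in> \<Union>C"
      obtain H where H: "H \<in> C" "(\<lambda>x. a \<odot>\<^bsub>M\<^esub> x) ` A \<subseteq> H"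
        using finite_subset_Union_chain[OF finite_imageI[OF A(1)] _ C, of "\<lambda>x. a \<odot>\<^bsub>M\<^esub> x"] a(2) A(2)
        by (metis (no_types, lifting) image_subset_iff subsetD)
      have H': "submodule H R M" "P H" using H(1) C(2) by (auto simp: subset_chain_def)
      have "submodule_hull R M A \<subseteq> {x \<in> carrier M. a \<odot>\<^bsub>M\<^esub> x \<in> H}"
        using H(2) A(2) by (intro submodule_hull_least submodule_colon[OF H'(1) a(1)]) auto
      then show "a \<in> p" using H'(2) a(1) A(3) by (auto simp: P_def)
    qed
  qed (rule that)
  note KE = submoduleE[OF K(1)]
  \<comment> \<open>Maximality of K, applied to K + R x.\<close>
  have grow: "\<exists>s\<in>carrier R - p. \<forall>y\<in>carrier M. \<exists>k\<in>K. \<exists>c\<in>carrier R. s \<odot>\<^bsub>M\<^esub> y = k \<oplus>\<^bsub>M\<^esub> c \<odot>\<^bsub>M\<^esub> x"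
    if x: "x \<in> carrier M" "x \<notin> K" for x
  proof -
    note L = submodule_add_cyclic[OF K(1) x(1)]
    have "\<not> P {y \<oplus>\<^bsub>M\<^esub> a \<odot>\<^bsub>M\<^esub> x |y a. y \<in> K \<and> a \<in> carrier R}"
      using max[OF L(1) _ L(2)] L(3) x(2) by blast
    then show ?thesis unfolding P_def by fastforce
  qed
  have cancel: "y \<in> K" if s: "s \<in> carrier R" "s \<notin> p" and y: "y \<in> carrier M" "s \<odot>\<^bsub>M\<^esub> y \<in> K" for s y
  proof (rule ccontr)
    assume "y \<notin> K"
    then obtain t where t: "t \<in> carrier R" "t \<notin> p"
      and tM: "\<And>z. z \<in> carrier M \<Longrightarrow> \<exists>k\<in>K. \<exists>c\<in>carrier R. t \<odot>\<^bsub>M\<^esub> z = k \<oplus>\<^bsub>M\<^esub> c \<odot>\<^bsub>M\<^esub> y"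
      using grow[OF y(1)] by blast
    have "(s \<otimes> t) \<odot>\<^bsub>M\<^esub> z \<in> K" if z: "z \<in> carrier M" for z
    proof -
      obtain k c where kc: "k \<in> K" "c \<in> carrier R" "t \<odot>\<^bsub>M\<^esub> z = k \<oplus>\<^bsub>M\<^esub> c \<odot>\<^bsub>M\<^esub> y"
        using tM[OF z] by blast
      then have "(s \<otimes> t) \<odot>\<^bsub>M\<^esub> z = s \<odot>\<^bsub>M\<^esub> k \<oplus>\<^bsub>M\<^esub> (s \<otimes> c) \<odot>\<^bsub>M\<^esub> y"
        using s t z y subsetD[OF KE(1) kc(1)] by (simp add: smult_assoc1 smult_r_distr)
      also have "(s \<otimes> c) \<odot>\<^bsub>M\<^esub> y = c \<odot>\<^bsub>M\<^esub> (s \<odot>\<^bsub>M\<^esub> y)"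
        using s kc(2) y by (simp add: R.m_comm flip: smult_assoc1)
      also have "s \<odot>\<^bsub>M\<^esub> k \<oplus>\<^bsub>M\<^esub> c \<odot>\<^bsub>M\<^esub> (s \<odot>\<^bsub>M\<^esub> y) \<in> K"
        using KE(4,5) kc s y by blast
      finally show ?thesis .
    qed
    then have "s \<otimes> t \<in> p" using K(2) s t by (simp add: P_def)
    then show False using pD(4) s t by blast
  qed
  have pM: "a \<odot>\<^bsub>M\<^esub> x \<in> K" if a: "a \<in> p" and x: "x \<in> carrier M" for a x
  proof (rule ccontr)
    assume no: "\<not> ?thesis"
    have aR: "a \<in> carrier R" using a pD(2) by blast
    then obtain t where t: "t \<in> carrier R" "t \<notin> p"
      and tM: "\<And>z. z \<in> carrier M \<Longrightarrow> \<exists>k\<in>K. \<exists>c\<in>carrier R. t \<odot>\<^bsub>M\<^esub> z = k \<oplus>\<^bsub>M\<^esub> c \<odot>\<^bsub>M\<^esub> (a \<odot>\<^bsub>M\<^esub> x)"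
      using grow[OF _ no] x by blast
    obtain k c where kc: "k \<in> K" "c \<in> carrier R" "t \<odot>\<^bsub>M\<^esub> x = k \<oplus>\<^bsub>M\<^esub> c \<odot>\<^bsub>M\<^esub> (a \<odot>\<^bsub>M\<^esub> x)"
      using tM[OF x] by blast
    \<comment> \<open>The element t - c a lies outside p and maps x into K, so x itself lies in K.\<close>
    let ?u = "t \<ominus> c \<otimes> a"
    have kM: "k \<in> carrier M" using kc(1) KE(1) by blast
    have "?u \<odot>\<^bsub>M\<^esub> x = t \<odot>\<^bsub>M\<^esub> x \<ominus>\<^bsub>M\<^esub> c \<odot>\<^bsub>M\<^esub> (a \<odot>\<^bsub>M\<^esub> x)"
      using t kc(2) aR x by (simp add: a_minus_def smult_l_distr smult_l_minus smult_assoc1)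
    also have "\<dots> = k"
      unfolding kc(3) using kM kc(2) aR x by (simp add: a_minus_def M.a_assoc M.r_neg)
    finally have "?u \<odot>\<^bsub>M\<^esub> x \<in> K" using kc(1) by simp
    moreover have "?u \<notin> p"
    proof
      assume "?u \<in> p"
      then have "?u \<oplus> c \<otimes> a \<in> p" using a kc(2) p.I_l_closed p.a_closed by blast
      moreover have "?u \<oplus> c \<otimes> a = t" using t kc(2) aR by (simp add: a_minus_def R.a_assoc R.l_neg)
      ultimately show False using t by simp
    qed
    ultimately have "x \<in> K" using cancel[of ?u x] t kc(2) aR x by simp
    then show False using no KE(4) aR by blast
  qed
  have "\<not> carrier M \<subseteq> K"
  proof
    assume "carrier M \<subseteq> K"
    then have "\<one> \<in> p" using K(2) R.one_closed unfolding P_def by (metis smult_closed subsetD)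
    then show False using pD(3) by simp
  qed
  then obtain x where x: "x \<in> carrier M" "x \<notin> K" by blast
  obtain s where s: "s \<in> carrier R" "s \<notin> p"
    and sM: "\<And>y. y \<in> carrier M \<Longrightarrow> \<exists>k\<in>K. \<exists>c\<in>carrier R. s \<odot>\<^bsub>M\<^esub> y = k \<oplus>\<^bsub>M\<^esub> c \<odot>\<^bsub>M\<^esub> x"
    using grow[OF x] by blast
  \<comment> \<open>The map sends y to c m, where s y and c x agree modulo K; such a c is unique modulo p.\<close>
  define good where "good y c \<longleftrightarrow> c \<in> carrier R \<and> (\<exists>k\<in>K. s \<odot>\<^bsub>M\<^esub> y = k \<oplus>\<^bsub>M\<^esub> c \<odot>\<^bsub>M\<^esub> x)" for y c
  define f where "f y = (SOME c. good y c) \<odot>\<^bsub>N\<^esub> m" for y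
  have uniq: "c \<odot>\<^bsub>N\<^esub> m = d \<odot>\<^bsub>N\<^esub> m" if c: "good y c" and d: "good y d" for y c d
  proof -
    have cd: "c \<in> carrier R" "d \<in> carrier R" using c d by (auto simp: good_def)
    obtain k l where kl: "k \<in> K" "l \<in> K" "k \<oplus>\<^bsub>M\<^esub> c \<odot>\<^bsub>M\<^esub> x = l \<oplus>\<^bsub>M\<^esub> d \<odot>\<^bsub>M\<^esub> x"
      using c d by (auto simp: good_def)
    then have klM: "k \<in> carrier M" "l \<in> carrier M" using KE(1) by auto
    have "(c \<ominus> d) \<odot>\<^bsub>M\<^esub> x = \<ominus>\<^bsub>M\<^esub> k \<oplus>\<^bsub>M\<^esub> (k \<oplus>\<^bsub>M\<^esub> c \<odot>\<^bsub>M\<^esub> x) \<oplus>\<^bsub>M\<^esub> \<ominus>\<^bsub>M\<^esub> (d \<odot>\<^bsub>M\<^esub> x)"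
      using cd klM x by (simp add: a_minus_def smult_l_distr smult_l_minus M.r_neg1)
    also have "\<dots> = l \<ominus>\<^bsub>M\<^esub> k"
      unfolding kl(3) using cd klM x by (simp add: a_minus_def M.a_ac M.r_neg M.r_neg1 M.r_neg2)
    finally have "(c \<ominus> d) \<odot>\<^bsub>M\<^esub> x \<in> K" using submodule_diff[OF K(1) kl(2,1)] by simp
    then have "c \<ominus> d \<in> p" using cancel[of "c \<ominus> d" x] cd x by auto
    then have "(c \<ominus> d) \<odot>\<^bsub>N\<^esub> m = \<zero>\<^bsub>N\<^esub>" using N(3) by (auto simp: annihilator_def)
    then have "c \<odot>\<^bsub>N\<^esub> m \<ominus>\<^bsub>N\<^esub> d \<odot>\<^bsub>N\<^esub> m = \<zero>\<^bsub>N\<^esub>"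
      using cd N(2) by (simp add: a_minus_def N.smult_l_distr N.smult_l_minus)
    then show ?thesis using N.diff_zero_iff cd N(2) by simp
  qed
  have f: "f y = c \<odot>\<^bsub>N\<^esub> m" if "good y c" for y c
    unfolding f_def using someI[of "good y", OF that] that by (rule uniq)
  have good: "\<exists>c. good y c" if "y \<in> carrier M" for y
    using sM[OF that] by (auto simp: good_def)
  have good_add: "good (y \<oplus>\<^bsub>M\<^esub> z) (c \<oplus> d)"
    if gcd: "good y c" "good z d" and yz: "y \<in> carrier M" "z \<in> carrier M" for y z c d
  proof -
    obtain k l where kl: "k \<in> K" "l \<in> K" "s \<odot>\<^bsub>M\<^esub> y = k \<oplus>\<^bsub>M\<^esub> c \<odot>\<^bsub>M\<^esub> x" "s \<odot>\<^bsub>M\<^esub> z = l \<oplus>\<^bsub>M\<^esub> d \<odot>\<^bsub>M\<^esub> x"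
      and cd: "c \<in> carrier R" "d \<in> carrier R"
      using gcd by (auto simp: good_def)
    then have klM: "k \<in> carrier M" "l \<in> carrier M" using KE(1) by auto
    have "s \<odot>\<^bsub>M\<^esub> (y \<oplus>\<^bsub>M\<^esub> z) = (k \<oplus>\<^bsub>M\<^esub> l) \<oplus>\<^bsub>M\<^esub> (c \<oplus> d) \<odot>\<^bsub>M\<^esub> x"
      using kl cd klM s yz x by (simp add: smult_r_distr smult_l_distr M.a_ac)
    then show ?thesis using KE(5)[OF kl(1,2)] cd by (auto simp: good_def)
  qed
  have good_smult: "good (a \<odot>\<^bsub>M\<^esub> y) (a \<otimes> c)"
    if gc: "good y c" and ay: "a \<in> carrier R" "y \<in> carrier M" for a y c
  proof -
    obtain k where k: "k \<in> K" "s \<odot>\<^bsub>M\<^esub> y = k \<oplus>\<^bsub>M\<^esub> c \<odot>\<^bsub>M\<^esub> x" and c: "c \<in> carrier R"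
      using gc by (auto simp: good_def)
    have kM: "k \<in> carrier M" using k KE(1) by auto
    have "s \<odot>\<^bsub>M\<^esub> (a \<odot>\<^bsub>M\<^esub> y) = a \<odot>\<^bsub>M\<^esub> (s \<odot>\<^bsub>M\<^esub> y)"
      using s ay by (simp add: R.m_comm flip: smult_assoc1)
    also have "\<dots> = a \<odot>\<^bsub>M\<^esub> k \<oplus>\<^bsub>M\<^esub> (a \<otimes> c) \<odot>\<^bsub>M\<^esub> x"
      unfolding k(2) using c kM ay x by (simp add: smult_r_distr smult_assoc1)
    finally show ?thesis using KE(4)[OF ay(1) k(1)] c ay by (auto simp: good_def)
  qed
  have lin: "f \<in> lin_maps R M N"
  proof (rule lin_mapsI)
    fix y assume y: "y \<in> carrier M"
    then obtain c where c: "good y c" using good by blast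
    then have cR: "c \<in> carrier R" by (simp add: good_def)
    show "f y \<in> carrier N" using f[OF c] cR N(2) by simp
    show "f (a \<odot>\<^bsub>M\<^esub> y) = a \<odot>\<^bsub>N\<^esub> f y" if a: "a \<in> carrier R" for a
      using f[OF c] f[OF good_smult[OF c a y]] a cR N(2) by (simp add: N.smult_assoc1)
    fix z assume z: "z \<in> carrier M"
    then obtain d where d: "good z d" using good by blast
    then have dR: "d \<in> carrier R" by (simp add: good_def)
    show "f (y \<oplus>\<^bsub>M\<^esub> z) = f y \<oplus>\<^bsub>N\<^esub> f z"
      using f[OF c] f[OF d] f[OF good_add[OF c d y z]] cR dR N(2) by (simp add: N.smult_l_distr)
  qed
  have "good x s"
    using s x submodule_zero[OF K(1)] by (auto simp: good_def intro!: bexI[of _ "\<zero>\<^bsub>M\<^esub>"])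
  then have "f x \<noteq> \<zero>\<^bsub>N\<^esub>" using f s N(3) by (auto simp: annihilator_def)
  then show ?thesis using lin x(1) by (auto simp: Hom_zero_def)
qed

text \<open>
  If \<open>f\<close> is a nonzero map, take an associated prime \<open>p\<close> of its image, say the annihilator of
  \<open>f y\<close>. It contains the annihilator of \<open>y\<close>, so \<open>M\<close> has an associated prime that misses the
  complement of \<open>p\<close>. Conversely, an associated prime of \<open>M\<close> contains the annihilator of \<open>M\<close>, so
  \<open>Hom_nonzero\<close> applies to any larger associated prime of \<open>N\<close>.
\<close>

theorem Hom_zero_iff_Ass:
  assumes "module R M" "module R N" "noetherian_ring R" "finitely_generated R M"
  shows "Hom_zero R M N \<longleftrightarrow> (\<forall>q\<in>Ass R M. \<forall>p\<in>Ass R N. \<not> q \<subseteq> p)"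
proof -
  interpret M: module R M by fact
  interpret N: module R N by fact
  have "\<not> Hom_zero R M N" if qp: "q \<in> Ass R M" "p \<in> Ass R N" "q \<subseteq> p" for p q
  proof -
    obtain x where x: "x \<in> carrier M" "annihilator R M x = q" using qp(1) by (rule AssE)
    obtain y where y: "p \<in> Spec R" "y \<in> carrier N" "annihilator R N y = p" using qp(2) by (rule AssE)
    show ?thesis
    proof (rule M.Hom_nonzero[OF assms(4) y(1) _ assms(2) y(2,3)])
      fix a assume "a \<in> carrier R" "\<And>x. x \<in> carrier M \<Longrightarrow> a \<odot>\<^bsub>M\<^esub> x = \<zero>\<^bsub>M\<^esub>"
      then have "a \<in> q" using x by (auto simp: annihilator_def)
      then show "a \<in> p" using qp(3) by blast
    qed
  qed
  moreover have "\<exists>q\<in>Ass R M. \<exists>p\<in>Ass R N. q \<subseteq> p" if nonzero: "\<not> Hom_zero R M N"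
  proof -
    obtain f x where f: "f \<in> lin_maps R M N" and x: "x \<in> carrier M" "f x \<noteq> \<zero>\<^bsub>N\<^esub>"
      using nonzero unfolding Hom_zero_def by blast
    obtain p u where p: "p \<in> Spec R" "u \<in> f ` carrier M" "annihilator R N u = p"
      using N.exists_prime_annihilator_in_submodule[OF assms(3) image_submodule[OF assms(1,2) f] _ x(2)] x(1) by blast
    then obtain y where y: "y \<in> carrier M" "u = f y" by blast
    have pN: "p \<in> Ass R N" using p y lin_mapsD(1)[OF f] by (auto simp: Ass_def)
    have yp: "annihilator R M y \<subseteq> p"
      using annihilator_lin_map(1)[OF assms(1,2) f y(1)] p(3) y(2) by simp
    note pD = SpecD[OF p(1)]
    obtain q where q: "q \<in> Ass R M" "q \<inter> (carrier R - p) = {}"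
    proof (rule M.exists_associated_prime_disjoint[OF assms(3), of "carrier R - p" y])
      show "s \<otimes>\<^bsub>R\<^esub> t \<in> carrier R - p" if "s \<in> carrier R - p" "t \<in> carrier R - p" for s t
        using that pD(4) by auto
    qed (use pD y(1) yp that in auto)
    have "q \<subseteq> carrier R" using q(1) SpecD(2) by (auto simp: Ass_def)
    then show ?thesis using q pN by blast
  qed
  ultimately show ?thesis by blast
qed


section \<open>Splitting off a set of associated primes\<close>

context module
begin

text \<open>
  As \<open>R x\<close> is a copy of \<open>R/p\<close>, all its nonzero elements have annihilator \<open>p\<close>. Either one of them
  lies in \<open>H\<close>, or \<open>R x\<close> embeds into the quotient by \<open>H\<close>.
\<close>

lemma Ass_extension:
  assumes "submodule H R M" "p \<in> Spec R" "x \<in> carrier M" "annihilator R M x = p"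
  obtains y where "y \<in> H" "annihilator R M y = p"
    | "\<And>a. a \<in> carrier R \<Longrightarrow> a \<odot>\<^bsub>M\<^esub> x \<in> H \<longleftrightarrow> a \<in> p"
proof (cases "\<exists>b\<in>carrier R. b \<notin> p \<and> b \<odot>\<^bsub>M\<^esub> x \<in> H")
  case True
  then show ?thesis using that(1) annihilator_smult_prime[OF assms(3,4,2)] by blast
next
  case False
  moreover have "a \<odot>\<^bsub>M\<^esub> x = \<zero>\<^bsub>M\<^esub>" if "a \<in> p" for a
    using that assms(4) by (auto simp: annihilator_def)
  ultimately show ?thesis using that(2) submodule_zero[OF assms(1)] by metis
qed

text \<open>
  Choose \<open>L\<close> maximal among the submodules with associated primes in \<open>\<Phi>\<close>. If \<open>p\<close> is the annihilator
  of the class of \<open>x\<close> in \<open>M/L\<close>, then \<open>L + R x\<close> has an associated prime \<open>q\<close> outside \<open>\<Phi>\<close>. It does not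
  come from \<open>L\<close>, so it is the annihilator of a nonzero element of \<open>(L + R x)/L\<close>, a copy of \<open>R/p\<close>;
  therefore \<open>q = p\<close>. Associated primes of \<open>M/L\<close> are phrased through \<open>L\<close>, which leaves open how the
  quotient is represented.
\<close>

lemma exists_submodule_splitting_Ass:
  obtains L where "submodule L R M" "Ass R (M\<lparr>carrier := L\<rparr>) \<subseteq> \<Phi>"
    "\<And>p x. p \<in> Spec R \<Longrightarrow> x \<in> carrier M \<Longrightarrow> {a \<in> carrier R. a \<odot>\<^bsub>M\<^esub> x \<in> L} = p \<Longrightarrow> p \<in> Ass R M - \<Phi>"
proof -
  have AssL: "p \<in> Ass R (M\<lparr>carrier := L\<rparr>) \<longleftrightarrow> p \<in> Spec R \<and> (\<exists>x\<in>L. annihilator R M x = p)" for p L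
    by (auto simp: Ass_def)
  obtain L where L: "submodule L R M" "Ass R (M\<lparr>carrier := L\<rparr>) \<subseteq> \<Phi>"
    and max: "\<And>K. submodule K R M \<Longrightarrow> Ass R (M\<lparr>carrier := K\<rparr>) \<subseteq> \<Phi> \<Longrightarrow> L \<subseteq> K \<Longrightarrow> K = L"
  proof (rule maximal_submodule[OF zero_submodule, of "\<lambda>L. Ass R (M\<lparr>carrier := L\<rparr>) \<subseteq> \<Phi>"])
    have "annihilator R M \<zero>\<^bsub>M\<^esub> = carrier R" by (auto simp: annihilator_def)
    moreover have "carrier R \<notin> Spec R" using SpecD(3) R.one_closed by blast
    ultimately show "Ass R (M\<lparr>carrier := {\<zero>\<^bsub>M\<^esub>}\<rparr>) \<subseteq> \<Phi>" by (auto simp: AssL)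
    show "Ass R (M\<lparr>carrier := \<Union>C\<rparr>) \<subseteq> \<Phi>"
      if "subset.chain {H. submodule H R M \<and> Ass R (M\<lparr>carrier := H\<rparr>) \<subseteq> \<Phi>} C" for C
      using that unfolding subset_chain_def by (force simp: AssL)
  qed (rule that)
  note LE = submoduleE[OF L(1)]
  show ?thesis
  proof (rule that[OF L])
    fix p x assume p: "p \<in> Spec R" and x: "x \<in> carrier M" and eq: "{a \<in> carrier R. a \<odot>\<^bsub>M\<^esub> x \<in> L} = p"
    note pD = SpecD[OF p]
    note K = submodule_add_cyclic[OF L(1) x]
    let ?K = "{y \<oplus>\<^bsub>M\<^esub> a \<odot>\<^bsub>M\<^esub> x |y a. y \<in> L \<and> a \<in> carrier R}"
    have "x \<notin> L" using eq pD(3) x by auto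
    then have "\<not> Ass R (M\<lparr>carrier := ?K\<rparr>) \<subseteq> \<Phi>" using max[OF K(1) _ K(2)] K(3) by blast
    then obtain q where "q \<in> Ass R (M\<lparr>carrier := ?K\<rparr>)" "q \<notin> \<Phi>" by blast
    then obtain u where q: "q \<in> Spec R" "q \<notin> \<Phi>" "u \<in> ?K" "annihilator R M u = q"
      unfolding AssL by blast
    then obtain l b where lb: "u = l \<oplus>\<^bsub>M\<^esub> b \<odot>\<^bsub>M\<^esub> x" "l \<in> L" "b \<in> carrier R" by blast
    have lM: "l \<in> carrier M" using lb(2) LE(1) by blast
    have uM: "u \<in> carrier M" using lb lM x by simp
    have "a \<odot>\<^bsub>M\<^esub> u \<in> L \<longleftrightarrow> a \<in> q" if "a \<in> carrier R" for a
    proof (rule Ass_extension[OF L(1) q(1) uM q(4)])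
      show ?thesis if "y \<in> L" "annihilator R M y = q" for y
        using that q(1,2) L(2) AssL by blast
    qed (use that in simp)
    moreover have "a \<odot>\<^bsub>M\<^esub> u \<in> L \<longleftrightarrow> a \<otimes> b \<in> p" if a: "a \<in> carrier R" for a
    proof -
      have au: "a \<odot>\<^bsub>M\<^esub> u = a \<odot>\<^bsub>M\<^esub> l \<oplus>\<^bsub>M\<^esub> (a \<otimes> b) \<odot>\<^bsub>M\<^esub> x"
        using a lb lM x by (simp add: smult_r_distr smult_assoc1)
      have al: "a \<odot>\<^bsub>M\<^esub> l \<in> L" using LE(4)[OF a lb(2)] .
      have bx: "(a \<otimes> b) \<odot>\<^bsub>M\<^esub> x = a \<odot>\<^bsub>M\<^esub> u \<ominus>\<^bsub>M\<^esub> a \<odot>\<^bsub>M\<^esub> l"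
        unfolding au using a lb lM x by (simp add: a_minus_def M.a_ac M.r_neg M.r_neg1 M.r_neg2)
      have "a \<odot>\<^bsub>M\<^esub> u \<in> L \<longleftrightarrow> (a \<otimes> b) \<odot>\<^bsub>M\<^esub> x \<in> L"
      proof
        show "(a \<otimes> b) \<odot>\<^bsub>M\<^esub> x \<in> L" if "a \<odot>\<^bsub>M\<^esub> u \<in> L"
          unfolding bx by (rule submodule_diff[OF L(1) that al])
        show "a \<odot>\<^bsub>M\<^esub> u \<in> L" if "(a \<otimes> b) \<odot>\<^bsub>M\<^esub> x \<in> L"
          unfolding au by (rule LE(5)[OF al that])
      qed
      also have "\<dots> \<longleftrightarrow> a \<otimes> b \<in> p" using eq a lb(3) by blast
      finally show ?thesis .
    qed
    ultimately have ab: "a \<in> q \<longleftrightarrow> a \<otimes> b \<in> p" if "a \<in> carrier R" for a using that by simp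
    have "b \<notin> p"
    proof
      assume "b \<in> p"
      then have "\<one> \<in> q" using ab[of \<one>] lb(3) by simp
      then show False using SpecD(3)[OF q(1)] by simp
    qed
    then have "q = p" using ab pD(2,4) SpecD(2)[OF q(1)] lb(3) by blast
    then show "p \<in> Ass R M - \<Phi>" using q uM by (auto simp: Ass_def)
  qed
qed

end


lemma mod_catD:
  assumes "M \<in> mod_cat R"
  shows "module R M" and "finitely_generated R M"
  using assms by (auto simp: mod_cat_def)

lemma Ass_short_exact:
  assumes "module R L" "module R M" "module R N" "short_exact R L M N f g"
  shows "Ass R L \<subseteq> Ass R M" and "Ass R M \<subseteq> Ass R L \<union> Ass R N"
proof -
  interpret M: module R M by fact
  interpret L: module R L by fact
  have f: "f \<in> lin_maps R L M" "inj_on f (carrier L)"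
    and g: "g \<in> lin_maps R M N"
    and ex: "f ` carrier L = {x \<in> carrier M. g x = \<zero>\<^bsub>N\<^esub>}"
    using assms(4) by (auto simp: short_exact_def)
  have f0: "y = \<zero>\<^bsub>L\<^esub>" if "y \<in> carrier L" "f y = \<zero>\<^bsub>M\<^esub>" for y
    using that lin_maps_zero[OF assms(1,2) f(1)] f(2) by (metis L.M.zero_closed inj_onD)
  show "Ass R L \<subseteq> Ass R M" by (rule Ass_injective[OF assms(1,2) f(1) f0])
  show "Ass R M \<subseteq> Ass R L \<union> Ass R N"
  proof
    fix p assume "p \<in> Ass R M"
    then obtain x where x: "p \<in> Spec R" "x \<in> carrier M" "annihilator R M x = p" by (rule AssE)
    show "p \<in> Ass R L \<union> Ass R N"
    proof (rule M.Ass_extension[OF image_submodule[OF assms(1,2) f(1)] x])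
      fix y assume "y \<in> f ` carrier L" and y: "annihilator R M y = p"
      then obtain l where l: "l \<in> carrier L" "y = f l" by blast
      then have "annihilator R L l = p"
        using annihilator_lin_map(2)[OF assms(1,2) f(1) l(1) f0] y by simp
      then show ?thesis using x(1) l(1) by (auto simp: Ass_def)
    next
      assume *: "\<And>a. a \<in> carrier R \<Longrightarrow> a \<odot>\<^bsub>M\<^esub> x \<in> f ` carrier L \<longleftrightarrow> a \<in> p"
      have "a \<odot>\<^bsub>N\<^esub> g x = \<zero>\<^bsub>N\<^esub> \<longleftrightarrow> a \<in> p" if "a \<in> carrier R" for a
        using *[OF that] that x(2) lin_mapsD(3)[OF g that x(2)] unfolding ex by simp
      then have "annihilator R N (g x) = p"
        using SpecD(2)[OF x(1)] by (auto simp: annihilator_def)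
      then show ?thesis using x lin_mapsD(1)[OF g] by (auto simp: Ass_def)
    qed
  qed
qed

theorem short_exact_splitting_Ass:
  assumes "noetherian_ring R" "M \<in> mod_cat R"
  obtains L N f g where "L \<in> mod_cat R" "N \<in> mod_cat R" "short_exact R L M N f g"
    "Ass R L \<subseteq> Ass R M \<inter> \<Phi>" "Ass R N \<subseteq> Ass R M - \<Phi>"
proof -
  interpret M: module R M by (rule mod_catD(1)[OF assms(2)])
  note fg = mod_catD(2)[OF assms(2)]
  obtain H where H: "submodule H R M" "Ass R (M\<lparr>carrier := H\<rparr>) \<subseteq> \<Phi>"
    and HQ: "\<And>p x. p \<in> Spec R \<Longrightarrow> x \<in> carrier M \<Longrightarrow> {a \<in> carrier R. a \<odot>\<^bsub>M\<^esub> x \<in> H} = p \<Longrightarrow>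
      p \<in> Ass R M - \<Phi>"
    by (rule M.exists_submodule_splitting_Ass[where \<Phi> = \<Phi>]; rule that)
  obtain Q g where Q: "Q \<in> mod_cat R" "g \<in> lin_maps R M Q" "g ` carrier M = carrier Q"
    and g0: "\<And>x. x \<in> carrier M \<Longrightarrow> g x = \<zero>\<^bsub>Q\<^esub> \<longleftrightarrow> x \<in> H"
    using quotient_in_mod_cat[OF M.module_axioms fg H(1)] by metis
  have HM: "H \<subseteq> carrier M" by (rule M.submoduleE(1)[OF H(1)])
  show ?thesis
  proof (rule that[of "M\<lparr>carrier := H\<rparr>" Q "\<lambda>x. x" g])
    show "M\<lparr>carrier := H\<rparr> \<in> mod_cat R"
      using M.submodule_module[OF H(1)] M.submodule_finitely_generated[OF assms(1) fg H(1)]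
      by (simp add: mod_cat_def)
    show "Q \<in> mod_cat R" by (rule Q(1))
    show "short_exact R (M\<lparr>carrier := H\<rparr>) M Q (\<lambda>x. x) g"
      using HM Q g0 by (auto simp: short_exact_def lin_maps_def hom_def)
    show "Ass R (M\<lparr>carrier := H\<rparr>) \<subseteq> Ass R M \<inter> \<Phi>"
      using H(2) Ass_restrict_subset[OF HM] by blast
    show "Ass R Q \<subseteq> Ass R M - \<Phi>"
    proof
      fix p assume "p \<in> Ass R Q"
      then obtain u where u: "p \<in> Spec R" "u \<in> carrier Q" "annihilator R Q u = p" by (rule AssE)
      then obtain x where x: "x \<in> carrier M" "u = g x" using Q(3) by blast
      have "a \<odot>\<^bsub>M\<^esub> x \<in> H \<longleftrightarrow> a \<odot>\<^bsub>Q\<^esub> u = \<zero>\<^bsub>Q\<^esub>" if "a \<in> carrier R" for a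
        using lin_mapsD(3)[OF Q(2) that x(1)] g0[of "a \<odot>\<^bsub>M\<^esub> x"] x that by simp
      then have "{a \<in> carrier R. a \<odot>\<^bsub>M\<^esub> x \<in> H} = p"
        using u(3) by (auto simp: annihilator_def)
      then show "p \<in> Ass R M - \<Phi>" by (rule HQ[OF u(1) x(1)])
    qed
  qed
qed


section \<open>Residue modules, nilpotent elements and minimal primes\<close>

definition ring_module :: "('a, 'm) ring_scheme \<Rightarrow> ('a, 'a) module" where
  "ring_module R = \<lparr>carrier = carrier R, mult = mult R, one = \<one>\<^bsub>R\<^esub>, zero = \<zero>\<^bsub>R\<^esub>,
     add = add R, smult = mult R\<rparr>"

lemma ring_module_simps [simp]:
  "carrier (ring_module R) = carrier R" "\<zero>\<^bsub>ring_module R\<^esub> = \<zero>\<^bsub>R\<^esub>"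
  "x \<oplus>\<^bsub>ring_module R\<^esub> y = x \<oplus>\<^bsub>R\<^esub> y" "a \<odot>\<^bsub>ring_module R\<^esub> x = a \<otimes>\<^bsub>R\<^esub> x"
  by (simp_all add: ring_module_def)

context cring
begin

lemma ring_module: "module R (ring_module R)"
proof (rule moduleI[OF is_cring])
  show "abelian_group (ring_module R)"
    by (rule abelian_groupI) (auto simp: a_assoc a_comm a_lcomm intro: bexI[of _ "\<ominus> x" for x] l_neg)
qed (simp_all add: l_distr r_distr m_assoc)

lemma ring_module_finitely_generated: "finitely_generated R (ring_module R)"
proof -
  interpret M: module R "ring_module R" by (rule ring_module)
  have "carrier R \<subseteq> submodule_hull R (ring_module R) {\<one>}"
  proof
    fix a assume a: "a \<in> carrier R"
    have "a \<odot>\<^bsub>ring_module R\<^esub> \<one> \<in> submodule_hull R (ring_module R) {\<one>}"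
      using a M.submodule_hull_superset[of "{\<one>}"]
      by (intro M.submoduleE(4)[OF M.submodule_hull_submodule]) auto
    then show "a \<in> submodule_hull R (ring_module R) {\<one>}" using a by simp
  qed
  then show ?thesis
    using M.submoduleE(1)[OF M.submodule_hull_submodule[of "{\<one>}"]]
    by (subst M.finitely_generated_iff_hull) (auto intro!: exI[of _ "{\<one>}"])
qed

text \<open>
  The module \<open>R/p\<close>, by its two properties used for the classification. It detects both membership of
  \<open>p\<close> in a set of primes and inclusion of an ideal in \<open>p\<close>.
\<close>

lemma exists_residue_module:
  assumes "p \<in> Spec R"
  obtains Q where "Q \<in> mod_cat R" "Ass R Q = {p}"
    "\<And>a. a \<in> carrier R \<Longrightarrow> (\<forall>x\<in>carrier Q. a \<odot>\<^bsub>Q\<^esub> x = \<zero>\<^bsub>Q\<^esub>) \<longleftrightarrow> a \<in> p"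
proof -
  interpret M: module R "ring_module R" by (rule ring_module)
  note pD = SpecD[OF assms]
  interpret p: ideal p R by (rule pD(1))
  have "submodule p R (ring_module R)"
    by (rule M.submoduleI_smult) (use pD(2) p.I_l_closed in auto)
  then obtain Q g where Q: "Q \<in> mod_cat R" "g \<in> lin_maps R (ring_module R) Q" "g ` carrier R = carrier Q"
    and g0: "\<And>x. x \<in> carrier R \<Longrightarrow> g x = \<zero>\<^bsub>Q\<^esub> \<longleftrightarrow> x \<in> p"
    using quotient_in_mod_cat[OF ring_module ring_module_finitely_generated]
    by (metis ring_module_simps(1))
  have kill: "a \<odot>\<^bsub>Q\<^esub> g b = \<zero>\<^bsub>Q\<^esub> \<longleftrightarrow> a \<in> p \<or> b \<in> p" if "a \<in> carrier R" "b \<in> carrier R" for a b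
    using lin_mapsD(3)[OF Q(2), of a b] g0[of "a \<otimes> b"] pD(4)[OF that] that by simp
  have ann: "annihilator R Q (g b) = (if b \<in> p then carrier R else p)" if "b \<in> carrier R" for b
    using kill[OF _ that] pD(2) by (auto simp: annihilator_def)
  have notSpec: "carrier R \<notin> Spec R" using SpecD(3) one_closed by blast
  show ?thesis
  proof (rule that[OF Q(1)])
    have "g \<one> \<in> carrier Q" using Q(3) by blast
    then have "p \<in> Ass R Q" using ann[OF one_closed] pD(3) assms by (auto simp: Ass_def)
    moreover have "q = p" if q: "q \<in> Ass R Q" for q
    proof -
      obtain b where "b \<in> carrier R" "annihilator R Q (g b) = q" "q \<in> Spec R"
        using q unfolding Ass_def Q(3)[symmetric] by auto
      then show ?thesis using ann notSpec by (metis (full_types))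
    qed
    ultimately show "Ass R Q = {p}" by blast
    show "(\<forall>x\<in>carrier Q. a \<odot>\<^bsub>Q\<^esub> x = \<zero>\<^bsub>Q\<^esub>) \<longleftrightarrow> a \<in> p" if "a \<in> carrier R" for a
      using kill[OF that] pD(3) unfolding Q(3)[symmetric] by auto
  qed
qed

lemma Spec_pow:
  assumes "p \<in> Spec R" "a \<in> carrier R" "a [^] (n::nat) \<in> p"
  shows "a \<in> p"
  using assms(3) SpecD(3,4)[OF assms(1)] assms(2) by (induction n) auto

lemma nilpotent_if_in_all_primes:
  assumes "noetherian_ring R" "a \<in> carrier R" "\<And>p. p \<in> Spec R \<Longrightarrow> a \<in> p"
  shows "\<exists>n::nat. a [^] n = \<zero>"
proof (rule ccontr)
  interpret M: module R "ring_module R" by (rule ring_module)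
  assume no: "\<not> ?thesis"
  obtain q where q: "q \<in> Ass R (ring_module R)" "q \<inter> range (\<lambda>n::nat. a [^] n) = {}"
  proof (rule M.exists_associated_prime_disjoint[OF assms(1), of "range (\<lambda>n::nat. a [^] n)" \<one>])
    show "range (\<lambda>n::nat. a [^] n) \<subseteq> carrier R" using assms(2) by auto
    show "\<one> \<in> range (\<lambda>n::nat. a [^] n)" by (rule range_eqI[of _ _ 0]) simp
    show "s \<otimes> t \<in> range (\<lambda>n::nat. a [^] n)"
      if st: "s \<in> range (\<lambda>n::nat. a [^] n)" "t \<in> range (\<lambda>n::nat. a [^] n)" for s t
    proof -
      obtain m n :: nat where "s = a [^] m" "t = a [^] n" using st by blast
      then have "s \<otimes> t = a [^] (m + n)" using assms(2) by (simp add: nat_pow_mult)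
      then show ?thesis by blast
    qed
    show "annihilator R (ring_module R) \<one> \<inter> range (\<lambda>n::nat. a [^] n) = {}"
      using no by (auto simp: annihilator_def)
  qed (use that in simp_all)
  have "q \<in> Spec R" using q(1) by (simp add: Ass_def)
  moreover have "a [^] (1::nat) \<notin> q" using q(2) by blast
  ultimately show False using assms(2,3) by simp
qed

text \<open>
  The intersection of a chain of primes is prime. Complements turn this into the form of Zorn's lemma
  for unions.
\<close>

lemma exists_minimal_prime_below:
  assumes "p \<in> Spec R"
  obtains q where "q \<in> Min_primes R" "q \<subseteq> p"
proof -
  let ?F = "{carrier R - q |q. q \<in> Spec R \<and> q \<subseteq> p}"
  have "\<exists>m\<in>?F. \<forall>x\<in>?F. m \<subseteq> x \<longrightarrow> x = m"
  proof (rule subset_Zorn_nonempty)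
    show "?F \<noteq> {}" using assms by blast
    fix C assume C: "C \<noteq> {}" "subset.chain ?F C"
    have chainC: "\<forall>X\<in>C. \<forall>Y\<in>C. X \<subseteq> Y \<or> Y \<subseteq> X"
      using C(2) unfolding subset_chain_def by (rule conjunct2)
    define Q where "Q = {q \<in> Spec R. q \<subseteq> p \<and> carrier R - q \<in> C}"
    have CQ: "C = (\<lambda>q. carrier R - q) ` Q"
      using C(2) unfolding Q_def subset_chain_def by blast
    have Qne: "Q \<noteq> {}" using C(1) CQ by blast
    have Q: "ideal q R" "q \<subseteq> carrier R" "q \<subseteq> p" "q \<in> Spec R" if "q \<in> Q" for q
      using that SpecD(1,2)[of q R] by (auto simp: Q_def)
    have chain: "q \<subseteq> r \<or> r \<subseteq> q" if "q \<in> Q" "r \<in> Q" for q r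
    proof -
      have "carrier R - q \<subseteq> carrier R - r \<or> carrier R - r \<subseteq> carrier R - q"
        using chainC that by (simp add: Q_def)
      then show ?thesis using Q(2)[OF that(1)] Q(2)[OF that(2)] by blast
    qed
    have "primeideal (\<Inter>Q) R"
    proof (rule primeidealI)
      show "ideal (\<Inter>Q) R" using i_Intersect[of Q] Q(1) Qne by blast
      show "cring R" by (rule is_cring)
      obtain q where "q \<in> Q" using Qne by blast
      then show "carrier R \<noteq> \<Inter>Q" using SpecD(3)[OF Q(4)] one_closed by blast
      fix a b assume ab: "a \<in> carrier R" "b \<in> carrier R" "a \<otimes> b \<in> \<Inter>Q"
      show "a \<in> \<Inter>Q \<or> b \<in> \<Inter>Q"
      proof (rule ccontr)
        assume "\<not> ?thesis"
        then obtain q r where qr: "q \<in> Q" "a \<notin> q" "r \<in> Q" "b \<notin> r" by blast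
        then obtain s where "s \<in> Q" "a \<notin> s" "b \<notin> s" using chain[OF qr(1,3)] by blast
        then show False using SpecD(4)[OF Q(4)] ab by blast
      qed
    qed
    moreover have "\<Inter>Q \<subseteq> p" using Qne Q(3) by blast
    moreover have "\<Union>C = carrier R - \<Inter>Q" unfolding CQ by blast
    ultimately show "\<Union>C \<in> ?F" by (auto simp: Spec_def)
  qed
  then obtain m where m: "m \<in> ?F" "\<forall>x\<in>?F. m \<subseteq> x \<longrightarrow> x = m" ..
  then obtain q where q: "q \<in> Spec R" "q \<subseteq> p" "m = carrier R - q" by blast
  have "r = q" if r: "r \<in> Spec R" "r \<subseteq> q" for r
  proof -
    have "carrier R - r \<in> ?F" using r q(2) by blast
    then have "carrier R - r = carrier R - q" using m(2) q(3) r(2) by blast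
    then show ?thesis using SpecD(2)[OF r(1)] SpecD(2)[OF q(1)] by blast
  qed
  then have "q \<in> Min_primes R" using q(1) unfolding Min_primes_def by blast
  then show ?thesis using that q(2) by blast
qed

end


section \<open>Closed and specialization-closed sets of primes\<close>

lemma specialization_closed_subsets_iff:
  assumes "cring R" "\<Delta> \<subseteq> Spec R"
  shows "Z \<in> specialization_closed_subsets R \<Delta> \<longleftrightarrow>
    Z \<subseteq> \<Delta> \<and> (\<forall>q\<in>Z. \<forall>p\<in>\<Delta>. q \<subseteq> p \<longrightarrow> p \<in> Z)"
proof -
  have top: "topspace (subtopology (zariski R) \<Delta>) = \<Delta>"
    using assms by (auto simp: topspace_zariski)
  have "subtopology (zariski R) \<Delta> closure_of {q} = {p \<in> \<Delta>. q \<subseteq> p}" if q: "q \<in> \<Delta>" for q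
  proof
    have "ideal q R" using q assms(2) by (auto intro: SpecD(1))
    then have "closedin (zariski R) (V R q)" using closedin_zariski[OF assms(1)] by blast
    moreover have "{p \<in> \<Delta>. q \<subseteq> p} = V R q \<inter> \<Delta>" using assms(2) by (auto simp: V_def)
    ultimately have "closedin (subtopology (zariski R) \<Delta>) {p \<in> \<Delta>. q \<subseteq> p}"
      by (auto simp: closedin_subtopology)
    then show "subtopology (zariski R) \<Delta> closure_of {q} \<subseteq> {p \<in> \<Delta>. q \<subseteq> p}"
      using q by (intro closure_of_minimal) auto
    show "{p \<in> \<Delta>. q \<subseteq> p} \<subseteq> subtopology (zariski R) \<Delta> closure_of {q}"
      using q assms(2) unfolding in_closure_of top subset_iff openin_subtopology openin_zariski[OF assms(1)]
      by (auto simp: in_closure_of top openin_subtopology openin_zariski[OF assms(1)] V_def)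
  qed
  then show ?thesis
    unfolding specialization_closed_subsets_def specialization_closedin_def top mem_Collect_eq by blast
qed

lemma closedin_subtopology_zariski:
  assumes "cring R"
  shows "closedin (subtopology (zariski R) \<Delta>) C \<longleftrightarrow> (\<exists>I. ideal I R \<and> C = V R I \<inter> \<Delta>)"
  by (auto simp: closedin_subtopology closedin_zariski[OF assms])

lemma complemented_closed_subset_specialization_closed:
  assumes "cring R" "\<Delta> \<subseteq> Spec R"
  shows "complemented_closed_subsets R \<Delta> \<subseteq> specialization_closed_subsets R \<Delta>"
proof
  fix C assume "C \<in> complemented_closed_subsets R \<Delta>"
  then obtain I where "C = V R I \<inter> \<Delta>"
    by (auto simp: complemented_closed_subsets_def closedin_subtopology_zariski[OF assms(1)])
  then show "C \<in> specialization_closed_subsets R \<Delta>"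
    unfolding specialization_closed_subsets_iff[OF assms] using assms(2) by (auto simp: V_def)
qed


section \<open>Classification of torsion pairs\<close>

lemma Ass_inv_mono: "\<Phi> \<subseteq> \<Psi> \<Longrightarrow> Ass_inv R \<Phi> \<subseteq> Ass_inv R \<Psi>"
  by (auto simp: Ass_inv_def)

lemma Ass_invD:
  assumes "M \<in> Ass_inv R \<Phi>"
  shows "M \<in> mod_cat R" and "module R M" and "finitely_generated R M" and "Ass R M \<subseteq> \<Phi>"
  using assms by (auto simp: Ass_inv_def mod_cat_def)

lemma subcategory_Ass_inv:
  assumes "\<Phi> \<subseteq> \<Delta>"
  shows "subcategory R (Ass_inv R \<Delta>) (Ass_inv R \<Phi>)"
  unfolding subcategory_def
proof (intro conjI ballI impI)
  show "Ass_inv R \<Phi> \<subseteq> Ass_inv R \<Delta>" by (rule Ass_inv_mono[OF assms])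
  fix M N assume M: "M \<in> Ass_inv R \<Phi>" and N: "N \<in> mod_cat R" "lin_iso R M N"
  have "Ass R N = Ass R M" by (rule Ass_lin_iso[OF Ass_invD(2)[OF M] mod_catD(1)[OF N(1)] N(2)])
  then show "N \<in> Ass_inv R \<Phi>" using Ass_invD(4)[OF M] N(1) by (simp add: Ass_inv_def)
qed

lemma extension_closed_Ass_inv: "extension_closed R (Ass_inv R \<Delta>)"
  unfolding extension_closed_def
proof (intro ballI impI, elim exE)
  fix L N M f g
  assume L: "L \<in> Ass_inv R \<Delta>" and N: "N \<in> Ass_inv R \<Delta>" and M: "M \<in> mod_cat R"
    and exact: "short_exact R L M N f g"
  have "Ass R M \<subseteq> Ass R L \<union> Ass R N"
    by (rule Ass_short_exact(2)[OF Ass_invD(2)[OF L] mod_catD(1)[OF M] Ass_invD(2)[OF N] exact])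
  then show "M \<in> Ass_inv R \<Delta>"
    using Ass_invD(4)[OF L] Ass_invD(4)[OF N] M by (auto simp: Ass_inv_def)
qed

definition Ass_pair :: "('a, 'm) ring_scheme \<Rightarrow> 'a set set \<Rightarrow> 'a set set \<Rightarrow> 'a mod_pair" where
  "Ass_pair R \<Delta> Z = (Ass_inv R Z, Ass_inv R (\<Delta> - Z))"

lemma Ass_pair_torsion_pair:
  assumes "cring R" "noetherian_ring R" "\<Delta> \<subseteq> Spec R" "Z \<in> specialization_closed_subsets R \<Delta>"
  shows "Ass_pair R \<Delta> Z \<in> torsion_pairs R (Ass_inv R \<Delta>)"
proof -
  have Z: "Z \<subseteq> \<Delta>" "\<And>q p. q \<in> Z \<Longrightarrow> p \<in> \<Delta> \<Longrightarrow> q \<subseteq> p \<Longrightarrow> p \<in> Z"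
    using assms(4) by (auto simp: specialization_closed_subsets_iff[OF assms(1,3)])
  have "Hom_zero R M N" if "M \<in> Ass_inv R Z" "N \<in> Ass_inv R (\<Delta> - Z)" for M N
    using Hom_zero_iff_Ass[OF Ass_invD(2)[OF that(1)] Ass_invD(2)[OF that(2)] assms(2)
        Ass_invD(3)[OF that(1)]] Ass_invD(4)[OF that(1)] Ass_invD(4)[OF that(2)] Z(2) by blast
  moreover have "\<exists>L\<in>Ass_inv R Z. \<exists>N\<in>Ass_inv R (\<Delta> - Z). \<exists>f g. short_exact R L M N f g"
    if M: "M \<in> Ass_inv R \<Delta>" for M
  proof -
    obtain L N f g where "L \<in> mod_cat R" "N \<in> mod_cat R" "short_exact R L M N f g"
      "Ass R L \<subseteq> Ass R M \<inter> Z" "Ass R N \<subseteq> Ass R M - Z"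
      using short_exact_splitting_Ass[OF assms(2) Ass_invD(1)[OF M]] .
    then show ?thesis using Ass_invD(4)[OF M]
      by (intro bexI[of _ L] bexI[of _ N] exI[of _ f] exI[of _ g]) (auto simp: Ass_inv_def)
  qed
  ultimately show ?thesis
    using subcategory_Ass_inv[OF Z(1), of R] subcategory_Ass_inv[of "\<Delta> - Z" \<Delta> R]
      extension_closed_Ass_inv
    by (simp add: torsion_pairs_def Ass_pair_def)
qed

text \<open>
  In the exact sequence \<open>0 \<rightarrow> L \<rightarrow> M \<rightarrow> N \<rightarrow> 0\<close> of \<open>M\<close>, orthogonality of \<open>M\<close> to \<open>F\<close> makes the second map
  zero, so that \<open>M\<close> is isomorphic to \<open>L\<close>. Orthogonality of \<open>T\<close> to \<open>M\<close> makes the first map zero, so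
  that \<open>M\<close> is isomorphic to \<open>N\<close>.
\<close>

lemma torsion_pair_imp_weak_torsion_pair:
  assumes "X \<subseteq> mod_cat R"
  shows "torsion_pairs R X \<subseteq> weak_torsion_pairs R X"
proof clarify
  fix T F assume TF: "(T, F) \<in> torsion_pairs R X"
  have sub: "subcategory R X T" "subcategory R X F"
    and hom: "\<And>M N. M \<in> T \<Longrightarrow> N \<in> F \<Longrightarrow> Hom_zero R M N"
    and ex: "\<And>M. M \<in> X \<Longrightarrow> \<exists>L\<in>T. \<exists>N\<in>F. \<exists>f g. short_exact R L M N f g"
    using TF by (auto simp: torsion_pairs_def)
  have mod: "M \<in> X" "module R M" if "M \<in> T \<union> F" for M
    using that sub assms by (auto simp: subcategory_def mod_cat_def)
  have iso: "M \<in> T" if "L \<in> T" "M \<in> X" "lin_iso R L M" for L M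
    using that sub(1) assms unfolding subcategory_def by blast
  have iso': "M \<in> F" if "L \<in> F" "M \<in> X" "lin_iso R L M" for L M
    using that sub(2) assms unfolding subcategory_def by blast
  have T: "M \<in> T" if M: "M \<in> X" "\<forall>N\<in>F. Hom_zero R M N" for M
  proof -
    obtain L N f g where LN: "L \<in> T" "N \<in> F" and fg: "short_exact R L M N f g"
      using ex[OF M(1)] by blast
    have "\<forall>x\<in>carrier M. g x = \<zero>\<^bsub>N\<^esub>" using M(2) LN(2) fg by (auto simp: Hom_zero_def short_exact_def)
    then have "lin_iso R L M"
      using fg unfolding lin_iso_def short_exact_def by (intro bexI[of _ f]) (auto intro: bij_betw_imageI)
    then show ?thesis using iso LN M by blast
  qed
  have F: "M \<in> F" if M: "M \<in> X" "\<forall>N\<in>T. Hom_zero R N M" for M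
  proof -
    obtain L N f g where LN: "L \<in> T" "N \<in> F" and fg: "short_exact R L M N f g"
      using ex[OF M(1)] by blast
    have modM: "module R M" and modN: "module R N" and modL: "module R L"
      using M(1) assms mod(2) LN by (auto simp: mod_cat_def)
    interpret M: module R M by (rule modM)
    interpret N: module R N by (rule modN)
    interpret L: module R L by (rule modL)
    have g: "g \<in> lin_maps R M N" using fg by (simp add: short_exact_def)
    have "\<forall>x\<in>carrier L. f x = \<zero>\<^bsub>M\<^esub>"
      using M(2) LN(1) fg by (auto simp: Hom_zero_def short_exact_def)
    then have ker: "x = \<zero>\<^bsub>M\<^esub>" if "x \<in> carrier M" "g x = \<zero>\<^bsub>N\<^esub>" for x
      using fg that by (auto simp: short_exact_def set_eq_iff image_iff)
    have "inj_on g (carrier M)"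
    proof (rule inj_onI)
      fix x y assume xy: "x \<in> carrier M" "y \<in> carrier M" "g x = g y"
      have "g (x \<ominus>\<^bsub>M\<^esub> y) = \<zero>\<^bsub>N\<^esub>"
        using lin_maps_diff[OF modM modN g xy(1,2)] xy lin_mapsD(1)[OF g] N.diff_zero_iff by simp
      then show "x = y" using ker[of "x \<ominus>\<^bsub>M\<^esub> y"] M.diff_zero_iff xy by simp
    qed
    then have "lin_iso R M N"
      using fg unfolding lin_iso_def short_exact_def by (intro bexI[of _ g]) (auto intro: bij_betw_imageI)
    then show ?thesis using iso' LN M lin_iso_sym[OF modM] by blast
  qed
  have "T = {M \<in> X. \<forall>N\<in>F. Hom_zero R M N}" using T hom mod(1) by auto
  moreover have "F = {M \<in> X. \<forall>N\<in>T. Hom_zero R N M}" using F hom mod(1) by auto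
  ultimately show "(T, F) \<in> weak_torsion_pairs R X"
    using sub by (simp add: weak_torsion_pairs_def)
qed

text \<open>
  By the criterion for \<open>Hom(M, N) = 0\<close>, a module is in \<open>F\<close> exactly if its associated primes avoid \<open>Z\<close>.
  The pair given by \<open>Z\<close> is itself a weak torsion pair with the same \<open>F\<close>, hence with the same \<open>T\<close>.
\<close>

lemma weak_torsion_pair_is_Ass_pair:
  assumes "cring R" "noetherian_ring R" "\<Delta> \<subseteq> Spec R"
    and P: "P \<in> weak_torsion_pairs R (Ass_inv R \<Delta>)"
  obtains Z where "Z \<in> specialization_closed_subsets R \<Delta>" "P = Ass_pair R \<Delta> Z"
proof -
  obtain T F where TF: "P = (T, F)" by (cases P)
  have sub: "T \<subseteq> Ass_inv R \<Delta>"
    and T: "T = {M \<in> Ass_inv R \<Delta>. \<forall>N\<in>F. Hom_zero R M N}"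
    and F: "F = {M \<in> Ass_inv R \<Delta>. \<forall>N\<in>T. Hom_zero R N M}"
    using P unfolding TF weak_torsion_pairs_def subcategory_def mem_Collect_eq prod.case
    by - (elim conjE; assumption)+
  define Z where "Z = {p \<in> \<Delta>. \<exists>N\<in>T. \<exists>q\<in>Ass R N. q \<subseteq> p}"
  have Z: "Z \<in> specialization_closed_subsets R \<Delta>"
    unfolding specialization_closed_subsets_iff[OF assms(1,3)] Z_def by blast
  have "M \<in> F \<longleftrightarrow> M \<in> Ass_inv R (\<Delta> - Z)" for M
  proof -
    have "(\<forall>N\<in>T. Hom_zero R N M) \<longleftrightarrow> Ass R M \<inter> Z = {}" if M: "M \<in> Ass_inv R \<Delta>"
    proof -
      have "Hom_zero R N M \<longleftrightarrow> (\<forall>q\<in>Ass R N. \<forall>p\<in>Ass R M. \<not> q \<subseteq> p)" if "N \<in> T" for N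
        using that sub Ass_invD(2,3)[of N R \<Delta>] Ass_invD(2)[OF M] assms(2)
        by (intro Hom_zero_iff_Ass) auto
      then have "(\<forall>N\<in>T. Hom_zero R N M) \<longleftrightarrow> (\<forall>p\<in>Ass R M. \<not> (\<exists>N\<in>T. \<exists>q\<in>Ass R N. q \<subseteq> p))"
        by blast
      also have "\<dots> \<longleftrightarrow> (\<forall>p\<in>Ass R M. p \<notin> Z)"
        using subsetD[OF Ass_invD(4)[OF M]] by (simp add: Z_def)
      finally show ?thesis by blast
    qed
    then show ?thesis by (subst F) (auto simp: Ass_inv_def)
  qed
  then have FZ: "F = Ass_inv R (\<Delta> - Z)" by blast
  have "Ass_pair R \<Delta> Z \<in> weak_torsion_pairs R (Ass_inv R \<Delta>)"
    using Ass_pair_torsion_pair[OF assms(1-3) Z] torsion_pair_imp_weak_torsion_pair[of "Ass_inv R \<Delta>" R]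
    by (auto simp: Ass_inv_def)
  then have "Ass_inv R Z = {M \<in> Ass_inv R \<Delta>. \<forall>N\<in>F. Hom_zero R M N}"
    unfolding weak_torsion_pairs_def Ass_pair_def FZ mem_Collect_eq prod.case
    by (elim conjE)
  then have "T = Ass_inv R Z" by (rule trans[OF T sym])
  then have "P = Ass_pair R \<Delta> Z" unfolding TF FZ Ass_pair_def by (rule arg_cong)
  then show ?thesis using that Z by blast
qed

theorem torsion_pairs_Ass_inv:
  assumes "cring R" "noetherian_ring R" "\<Delta> \<subseteq> Spec R"
  shows "torsion_pairs R (Ass_inv R \<Delta>) = Ass_pair R \<Delta> ` specialization_closed_subsets R \<Delta>"
    and "weak_torsion_pairs R (Ass_inv R \<Delta>) = Ass_pair R \<Delta> ` specialization_closed_subsets R \<Delta>"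
proof -
  have "Ass_inv R \<Delta> \<subseteq> mod_cat R" by (auto simp: Ass_inv_def)
  note tw = torsion_pair_imp_weak_torsion_pair[OF this]
  have wa: "weak_torsion_pairs R (Ass_inv R \<Delta>) \<subseteq> Ass_pair R \<Delta> ` specialization_closed_subsets R \<Delta>"
    using weak_torsion_pair_is_Ass_pair[OF assms] by (metis image_eqI subsetI)
  have at: "Ass_pair R \<Delta> ` specialization_closed_subsets R \<Delta> \<subseteq> torsion_pairs R (Ass_inv R \<Delta>)"
    using Ass_pair_torsion_pair[OF assms] by blast
  show "torsion_pairs R (Ass_inv R \<Delta>) = Ass_pair R \<Delta> ` specialization_closed_subsets R \<Delta>"
    and "weak_torsion_pairs R (Ass_inv R \<Delta>) = Ass_pair R \<Delta> ` specialization_closed_subsets R \<Delta>"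
    using tw wa at by auto
qed

definition torsion_primes :: "('a, 'm) ring_scheme \<Rightarrow> 'a mod_pair \<Rightarrow> 'a set set" where
  "torsion_primes R P = (\<Union>M\<in>fst P. Ass R M)"

lemma torsion_primes_Ass_pair:
  assumes "cring R" "Z \<subseteq> Spec R"
  shows "torsion_primes R (Ass_pair R \<Delta> Z) = Z"
proof
  show "torsion_primes R (Ass_pair R \<Delta> Z) \<subseteq> Z"
    by (auto simp: torsion_primes_def Ass_pair_def Ass_inv_def)
  show "Z \<subseteq> torsion_primes R (Ass_pair R \<Delta> Z)"
  proof
    fix p assume p: "p \<in> Z"
    then have "p \<in> Spec R" using assms(2) by blast
    then obtain Q where "Q \<in> mod_cat R" "Ass R Q = {p}"
      by (rule cring.exists_residue_module[OF assms(1)])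
    then show "p \<in> torsion_primes R (Ass_pair R \<Delta> Z)"
      using p by (auto simp: torsion_primes_def Ass_pair_def Ass_inv_def)
  qed
qed


section \<open>Basic torsion pairs\<close>

text \<open>
  For \<open>p\<close> in \<open>\<Delta>\<close> the module \<open>R/p\<close> belongs to the category, it is annihilated by \<open>I\<close> exactly if \<open>p\<close>
  contains \<open>I\<close>, and its only associated prime is \<open>p\<close>.
\<close>

lemma Ass_inv_annihilated_imp_closed:
  assumes "cring R" "\<Delta> \<subseteq> Spec R" "Z \<subseteq> \<Delta>" "ideal I R"
    and "Ass_inv R Z = annihilated_by R (Ass_inv R \<Delta>) I"
  shows "Z = V R I \<inter> \<Delta>"
proof -
  have "p \<in> Z \<longleftrightarrow> I \<subseteq> p" if p: "p \<in> \<Delta>" for p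
  proof -
    obtain Q where Q: "Q \<in> mod_cat R" "Ass R Q = {p}"
      "\<And>a. a \<in> carrier R \<Longrightarrow> (\<forall>x\<in>carrier Q. a \<odot>\<^bsub>Q\<^esub> x = \<zero>\<^bsub>Q\<^esub>) \<longleftrightarrow> a \<in> p"
      by (rule cring.exists_residue_module[OF assms(1) subsetD[OF assms(2) p]]; rule that)
    have "p \<in> Z \<longleftrightarrow> Q \<in> Ass_inv R Z" using Q by (auto simp: Ass_inv_def)
    also have "\<dots> \<longleftrightarrow> I \<subseteq> p"
      unfolding assms(5) annihilated_by_def using Q p ideal.Icarr[OF assms(4)] by (auto simp: Ass_inv_def)
    finally show ?thesis .
  qed
  then show ?thesis using assms(2,3) by (auto simp: V_def)
qed

lemma mult_nilpotent_if_min_primes_covered: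
  assumes "cring R" "noetherian_ring R" "ideal I R" "ideal J R"
    and "Min_primes R \<subseteq> V R I \<union> V R J" "a \<in> I" "b \<in> J"
  shows "\<exists>n::nat. (a \<otimes>\<^bsub>R\<^esub> b) [^]\<^bsub>R\<^esub> n = \<zero>\<^bsub>R\<^esub>"
proof -
  interpret cring R by fact
  have ab: "a \<in> carrier R" "b \<in> carrier R" using assms by (auto intro: ideal.Icarr)
  show ?thesis
  proof (rule nilpotent_if_in_all_primes[OF assms(2)])
    fix p assume p: "p \<in> Spec R"
    then obtain q where q: "q \<in> Min_primes R" "q \<subseteq> p" by (rule exists_minimal_prime_below)
    have "I \<subseteq> q \<or> J \<subseteq> q" using q(1) assms(5) by (auto simp: V_def)
    then have "a \<in> p \<or> b \<in> p" using q(2) assms(6,7) by blast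
    then show "a \<otimes>\<^bsub>R\<^esub> b \<in> p" by (simp add: SpecD(4)[OF p ab])
  qed (use ab in simp)
qed

text \<open>
  The ideal \<open>K\<close> is the common annihilator of all modules with associated primes in \<open>V(I)\<close>, and the point
  is that it contains a power of each \<open>a\<close> in \<open>I\<close>, independently of the module. As \<open>J\<close> has finitely
  many generators \<open>b\<close> and each \<open>ab\<close> is nilpotent, one exponent \<open>n\<close> makes every \<open>b^n\<close> annihilate
  \<open>a^n\<close>. If \<open>a^n x\<close> were nonzero, then the submodule killed by all \<open>b^n\<close> would be nonzero and its
  associated primes would contain \<open>J\<close>, although they are in \<open>V(I)\<close> and in \<open>\<Delta>\<close>.
\<close>

lemma complemented_closed_annihilated:
  assumes "cring R" "noetherian_ring R" "\<Delta> \<subseteq> Spec R" "Min_primes R \<subseteq> \<Delta>"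
    and I: "ideal I R" and J: "ideal J R"
    and cover: "V R I \<inter> \<Delta> \<union> V R J \<inter> \<Delta> = \<Delta>" and disj: "V R I \<inter> \<Delta> \<inter> (V R J \<inter> \<Delta>) = {}"
  shows "\<exists>K. ideal K R \<and> Ass_inv R (V R I \<inter> \<Delta>) = annihilated_by R (Ass_inv R \<Delta>) K"
proof -
  interpret R: cring R by fact
  interpret N: noetherian_ring R by fact
  let ?T = "Ass_inv R (V R I \<inter> \<Delta>)"
  \<comment> \<open>The carrier makes the family visibly nonempty, as an intersection of ideals requires.\<close>
  let ?K = "\<Inter>(insert (carrier R) {annihilator R M x |M x. M \<in> ?T \<and> x \<in> carrier M})"
  have K: "ideal ?K R"
  proof (rule R.i_Intersect)
    fix A assume "A \<in> insert (carrier R) {annihilator R M x |M x. M \<in> ?T \<and> x \<in> carrier M}"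
    then show "ideal A R"
      using R.oneideal module.annihilator_ideal[OF Ass_invD(2)] by blast
  qed simp
  obtain B where B: "B \<subseteq> carrier R" "finite B" "J = Idl\<^bsub>R\<^esub> B"
    using N.finetely_gen[OF J] by blast
  have BJ: "B \<subseteq> J" using R.genideal_self[OF B(1)] B(3) by simp
  have Min: "Min_primes R \<subseteq> V R I \<union> V R J" using assms(4) cover by blast
  have power_in_K: "\<exists>n::nat. a [^]\<^bsub>R\<^esub> n \<in> ?K" if a: "a \<in> I" for a
  proof -
    have aR: "a \<in> carrier R" by (rule ideal.Icarr[OF I a])
    have "\<exists>n::nat. (a \<otimes>\<^bsub>R\<^esub> b) [^]\<^bsub>R\<^esub> n = \<zero>\<^bsub>R\<^esub>" if "b \<in> B" for b
      by (rule mult_nilpotent_if_min_primes_covered[OF assms(1,2) I J Min a]) (use that BJ in blast)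
    then obtain e :: "'a \<Rightarrow> nat" where e: "\<And>b. b \<in> B \<Longrightarrow> (a \<otimes>\<^bsub>R\<^esub> b) [^]\<^bsub>R\<^esub> e b = \<zero>\<^bsub>R\<^esub>" by metis
    define n where "n = (\<Sum>b\<in>B. e b)"
    have kill: "b [^]\<^bsub>R\<^esub> n \<otimes>\<^bsub>R\<^esub> a [^]\<^bsub>R\<^esub> n = \<zero>\<^bsub>R\<^esub>" if b: "b \<in> B" for b
    proof -
      have bR: "b \<in> carrier R" using b B(1) by blast
      have "e b \<le> n" unfolding n_def using b B(2) by (intro member_le_sum) auto
      then obtain k where k: "n = e b + k" using le_Suc_ex by blast
      have "b [^]\<^bsub>R\<^esub> n \<otimes>\<^bsub>R\<^esub> a [^]\<^bsub>R\<^esub> n = (a \<otimes>\<^bsub>R\<^esub> b) [^]\<^bsub>R\<^esub> n"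
        using aR bR by (simp add: R.nat_pow_distrib R.m_comm)
      also have "\<dots> = (a \<otimes>\<^bsub>R\<^esub> b) [^]\<^bsub>R\<^esub> e b \<otimes>\<^bsub>R\<^esub> (a \<otimes>\<^bsub>R\<^esub> b) [^]\<^bsub>R\<^esub> k"
        unfolding k using aR bR by (simp add: R.nat_pow_mult)
      finally show ?thesis using e[OF b] aR bR by simp
    qed
    have "a [^]\<^bsub>R\<^esub> n \<odot>\<^bsub>M\<^esub> x = \<zero>\<^bsub>M\<^esub>" if M: "M \<in> ?T" and x: "x \<in> carrier M" for M x
    proof (rule ccontr)
      assume no: "\<not> ?thesis"
      interpret M: module R M by (rule Ass_invD(2)[OF M])
      let ?H = "{y \<in> carrier M. \<forall>b\<in>B. b [^]\<^bsub>R\<^esub> n \<odot>\<^bsub>M\<^esub> y = \<zero>\<^bsub>M\<^esub>}"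
      have BR: "b [^]\<^bsub>R\<^esub> n \<in> carrier R" if "b \<in> B" for b using that B(1) by auto
      have H: "submodule ?H R M"
      proof (rule M.submoduleI_smult)
        fix c y assume c: "c \<in> carrier R" and y: "y \<in> ?H"
        have "b [^]\<^bsub>R\<^esub> n \<odot>\<^bsub>M\<^esub> (c \<odot>\<^bsub>M\<^esub> y) = c \<odot>\<^bsub>M\<^esub> (b [^]\<^bsub>R\<^esub> n \<odot>\<^bsub>M\<^esub> y)" if "b \<in> B" for b
          using c y BR[OF that] by (simp add: R.m_comm flip: M.smult_assoc1)
        then show "c \<odot>\<^bsub>M\<^esub> y \<in> ?H" using c y by auto
      qed (use BR in \<open>auto simp: M.smult_r_distr\<close>)
      have "a [^]\<^bsub>R\<^esub> n \<odot>\<^bsub>M\<^esub> x \<in> ?H"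
        using x aR BR kill by (auto simp flip: M.smult_assoc1)
      then obtain p y where p: "p \<in> Spec R" "y \<in> ?H" "annihilator R M y = p"
        using M.exists_prime_annihilator_in_submodule[OF assms(2) H _ no] by blast
      have "p \<in> Ass R M" using p by (auto simp: Ass_def)
      then have pI: "p \<in> V R I \<inter> \<Delta>" using Ass_invD(4)[OF M] by blast
      have "B \<subseteq> p"
      proof
        fix b assume b: "b \<in> B"
        have "b [^]\<^bsub>R\<^esub> n \<in> p" using p(2,3) BR[OF b] b by (auto simp: annihilator_def)
        then show "b \<in> p" using R.Spec_pow[OF p(1)] b B(1) by blast
      qed
      then have "J \<subseteq> p" unfolding B(3) by (rule R.genideal_minimal[OF SpecD(1)[OF p(1)]])
      then show False using pI p(1) disj by (auto simp: V_def)
    qed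
    then have "a [^]\<^bsub>R\<^esub> n \<in> ?K" using aR by (auto simp: annihilator_def)
    then show ?thesis by blast
  qed
  have "?T = annihilated_by R (Ass_inv R \<Delta>) ?K"
  proof
    show "?T \<subseteq> annihilated_by R (Ass_inv R \<Delta>) ?K"
    proof
      fix M assume M: "M \<in> ?T"
      then have "M \<in> Ass_inv R \<Delta>" using Ass_inv_mono[of "V R I \<inter> \<Delta>" \<Delta> R] by blast
      moreover have "a \<odot>\<^bsub>M\<^esub> x = \<zero>\<^bsub>M\<^esub>" if "a \<in> ?K" "x \<in> carrier M" for a x
      proof -
        have "a \<in> annihilator R M x" using that M by blast
        then show ?thesis by (simp add: annihilator_def)
      qed
      ultimately show "M \<in> annihilated_by R (Ass_inv R \<Delta>) ?K" by (simp add: annihilated_by_def)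
    qed
    show "annihilated_by R (Ass_inv R \<Delta>) ?K \<subseteq> ?T"
    proof
      fix M assume "M \<in> annihilated_by R (Ass_inv R \<Delta>) ?K"
      then have M: "M \<in> Ass_inv R \<Delta>" and KM: "\<And>a x. a \<in> ?K \<Longrightarrow> x \<in> carrier M \<Longrightarrow> a \<odot>\<^bsub>M\<^esub> x = \<zero>\<^bsub>M\<^esub>"
        unfolding annihilated_by_def by blast+
      have "p \<in> V R I \<inter> \<Delta>" if pM: "p \<in> Ass R M" for p
      proof -
        obtain x where x: "p \<in> Spec R" "x \<in> carrier M" "annihilator R M x = p"
          using pM by (rule AssE)
        have "I \<subseteq> p"
        proof
          fix a assume a: "a \<in> I"
          obtain n :: nat where n: "a [^]\<^bsub>R\<^esub> n \<in> ?K" using power_in_K[OF a] by blast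
          have aR: "a \<in> carrier R" by (rule ideal.Icarr[OF I a])
          have "a [^]\<^bsub>R\<^esub> n \<in> p" using KM[OF n x(2)] x(3) aR by (auto simp: annihilator_def)
          then show "a \<in> p" by (rule R.Spec_pow[OF x(1) aR])
        qed
        then show ?thesis using x(1) pM Ass_invD(4)[OF M] by (auto simp: V_def)
      qed
      then show "M \<in> ?T" using Ass_invD(1)[OF M] by (auto simp: Ass_inv_def)
    qed
  qed
  then show ?thesis using K by blast
qed

lemma torsion_primes_basic:
  assumes "cring R" "noetherian_ring R" "\<Delta> \<subseteq> Spec R"
    and P: "P \<in> basic_torsion_pairs R (Ass_inv R \<Delta>)"
  shows "torsion_primes R P \<in> complemented_closed_subsets R \<Delta>"
proof -
  obtain I J where P': "P \<in> torsion_pairs R (Ass_inv R \<Delta>)" and IJ: "ideal I R" "ideal J R"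
    "fst P = annihilated_by R (Ass_inv R \<Delta>) I" "snd P = annihilated_by R (Ass_inv R \<Delta>) J"
    using P unfolding basic_torsion_pairs_def by auto
  then obtain Z where Z: "Z \<in> specialization_closed_subsets R \<Delta>" "P = Ass_pair R \<Delta> Z"
    unfolding torsion_pairs_Ass_inv(1)[OF assms(1-3)] by blast
  have ZD: "Z \<subseteq> \<Delta>" using Z(1) specialization_closed_subsets_iff[OF assms(1,3)] by blast
  have "Z = V R I \<inter> \<Delta>" "\<Delta> - Z = V R J \<inter> \<Delta>"
    using Ass_inv_annihilated_imp_closed[OF assms(1,3)] ZD IJ Z(2) by (auto simp: Ass_pair_def)
  then have "Z \<in> complemented_closed_subsets R \<Delta>"
    using IJ(1,2) ZD unfolding complemented_closed_subsets_def closedin_subtopology_zariski[OF assms(1)]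
    by (intro CollectI conjI exI[of _ "\<Delta> - Z"]) auto
  moreover have "torsion_primes R P = Z"
    unfolding Z(2) using ZD assms(3) by (intro torsion_primes_Ass_pair[OF assms(1)]) blast
  ultimately show ?thesis by simp
qed

lemma Ass_pair_basic:
  assumes "cring R" "noetherian_ring R" "\<Delta> \<subseteq> Spec R" "Min_primes R \<subseteq> \<Delta>"
    and "C \<in> complemented_closed_subsets R \<Delta>"
  shows "Ass_pair R \<Delta> C \<in> basic_torsion_pairs R (Ass_inv R \<Delta>)"
proof -
  obtain I J where IJ: "ideal I R" "ideal J R" "C = V R I \<inter> \<Delta>"
    and cover: "V R I \<inter> \<Delta> \<union> V R J \<inter> \<Delta> = \<Delta>" and disj: "V R I \<inter> \<Delta> \<inter> (V R J \<inter> \<Delta>) = {}"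
    using assms(5) unfolding complemented_closed_subsets_def closedin_subtopology_zariski[OF assms(1)]
    by blast
  have compl: "\<Delta> - C = V R J \<inter> \<Delta>" using IJ(3) cover disj by blast
  obtain K where K: "ideal K R" "Ass_inv R C = annihilated_by R (Ass_inv R \<Delta>) K"
    using complemented_closed_annihilated[OF assms(1-4) IJ(1,2) cover disj] IJ(3) by blast
  obtain K' where K': "ideal K' R" "Ass_inv R (\<Delta> - C) = annihilated_by R (Ass_inv R \<Delta>) K'"
    using complemented_closed_annihilated[OF assms(1-4) IJ(2,1)] cover disj compl
    by (metis Int_commute Un_commute)
  have "C \<in> specialization_closed_subsets R \<Delta>"
    using complemented_closed_subset_specialization_closed[OF assms(1,3)] assms(5) by blast
  then have "Ass_pair R \<Delta> C \<in> torsion_pairs R (Ass_inv R \<Delta>)"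
    by (rule Ass_pair_torsion_pair[OF assms(1-3)])
  then show ?thesis
    using K K' unfolding basic_torsion_pairs_def Ass_pair_def by blast
qed

theorem theorem1p1:
  fixes R :: "('a, 'm) ring_scheme" and \<Delta> :: "'a set set"
  assumes "cring R" and "noetherian_ring R" and "\<Delta> \<subseteq> Spec R"
  shows "weak_torsion_pairs R (Ass_inv R \<Delta>) = torsion_pairs R (Ass_inv R \<Delta>) \<and>
    basic_torsion_pairs R (Ass_inv R \<Delta>) \<subseteq> torsion_pairs R (Ass_inv R \<Delta>) \<and>
    complemented_closed_subsets R \<Delta> \<subseteq> specialization_closed_subsets R \<Delta> \<and>
    (\<exists>(\<sigma> :: 'a mod_pair \<Rightarrow> 'a set set) (\<tau> :: 'a mod_pair \<Rightarrow> 'a set set).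
      bij_betw \<sigma> (torsion_pairs R (Ass_inv R \<Delta>)) (specialization_closed_subsets R \<Delta>) \<and>
      \<tau> \<in> basic_torsion_pairs R (Ass_inv R \<Delta>) \<rightarrow> complemented_closed_subsets R \<Delta> \<and>
      (\<forall>P \<in> basic_torsion_pairs R (Ass_inv R \<Delta>). \<sigma> P = \<tau> P) \<and>
      (Min_primes R \<subseteq> \<Delta> \<longrightarrow>
        bij_betw \<tau> (basic_torsion_pairs R (Ass_inv R \<Delta>)) (complemented_closed_subsets R \<Delta>)))"
proof -
  let ?X = "Ass_inv R \<Delta>"
  let ?S = "specialization_closed_subsets R \<Delta>"
  let ?\<sigma> = "torsion_primes R"
  have weak: "weak_torsion_pairs R ?X = torsion_pairs R ?X"
    using torsion_pairs_Ass_inv[OF assms] by simp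
  have basic: "basic_torsion_pairs R ?X \<subseteq> torsion_pairs R ?X"
    by (auto simp: basic_torsion_pairs_def)
  note compl = complemented_closed_subset_specialization_closed[OF assms(1,3)]
  have inv: "?\<sigma> (Ass_pair R \<Delta> Z) = Z" if "Z \<in> ?S" for Z
    using that assms(3) specialization_closed_subsets_iff[OF assms(1,3)]
    by (intro torsion_primes_Ass_pair[OF assms(1)]) blast
  have bij: "bij_betw ?\<sigma> (torsion_pairs R ?X) ?S"
    unfolding torsion_pairs_Ass_inv(1)[OF assms]
    by (rule bij_betw_byWitness[where f' = "Ass_pair R \<Delta>"]) (use inv in auto)
  have maps: "?\<sigma> \<in> basic_torsion_pairs R ?X \<rightarrow> complemented_closed_subsets R \<Delta>"
    using torsion_primes_basic[OF assms] by blast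
  have bij_basic: "bij_betw ?\<sigma> (basic_torsion_pairs R ?X) (complemented_closed_subsets R \<Delta>)"
    if Min: "Min_primes R \<subseteq> \<Delta>"
  proof (rule bij_betw_imageI)
    show "inj_on ?\<sigma> (basic_torsion_pairs R ?X)"
      using bij_betw_imp_inj_on[OF bij] basic by (rule inj_on_subset)
    show "?\<sigma> ` basic_torsion_pairs R ?X = complemented_closed_subsets R \<Delta>"
    proof
      show "?\<sigma> ` basic_torsion_pairs R ?X \<subseteq> complemented_closed_subsets R \<Delta>" using maps by blast
      show "complemented_closed_subsets R \<Delta> \<subseteq> ?\<sigma> ` basic_torsion_pairs R ?X"
      proof
        fix C assume C: "C \<in> complemented_closed_subsets R \<Delta>"
        then have "?\<sigma> (Ass_pair R \<Delta> C) = C" using compl by (intro inv) blast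
        then show "C \<in> ?\<sigma> ` basic_torsion_pairs R ?X"
          using imageI[OF Ass_pair_basic[OF assms Min C], of ?\<sigma>] by simp
      qed
    qed
  qed
  show ?thesis
    by (intro conjI exI[of _ ?\<sigma>] ballI impI refl weak basic compl bij maps bij_basic)
qed

end
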